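(* For every special $\Pi^0_1$ sets $P,Q\subseteq2^{\mathbb N}$, and for any $R\subseteq\mathbb N^{\mathbb N}$, if $P\le^1_\omega(Q\blacktriangledown P)\otimes R$ then $P\le^1_\omega R$.
   Context: A set is special if it is nonempty and contains no computable element. For $f,g\in\mathbb N^{\mathbb N}$, $(f\oplus g)(2n)=f(n)$ and $(f\oplus g)(2n+1)=g(n)$; $A\otimes B=\{f\oplus g:f\in A,\ g\in B\}$. With each $\Pi^0_1$ set $P\subseteq2^{\mathbb N}$ (given by an index) a corresponding computable tree $T_P\subseteq2^{<\mathbb N}$ whose set of infinite paths is $P$ is fixed; $L_P$ is the set of leaves (dead ends) of $T_P$. The hyperconcatenation $Q\blacktriangledown P$ is the iterated concatenation of copies of $P$ along the tree $T_Q$: it is the set of infinite paths of the tree of all initial segments of strings of the form $$\rho_0{}^\frown\langle\tau(0)\rangle^\frown\rho_1{}^\frown\langle\tau(1)\rangle^\frown\cdots{}^\frown\rho_{n-1}{}^\frown\langle\tau(n-1)\rangle^\frown\sigma,$$ where $\tau\in T_Q$, $n=|\tau|$, $\rho_0,\dots,\rho_{n-1}\in L_P$ and $\sigma\in T_P$. Let $\{\Phi_e\}_{e\in\mathbb N}$ be an effective enumeration of all partial computable functions $\Phi_e:\subseteq\mathbb N^{\mathbb N}\to\mathbb N^{\mathbb N}$. A learner is a total computable function $\Psi:\mathbb N^{<\mathbb N}\to\mathbb N$. For $A,B\subseteq\mathbb N^{\mathbb N}$, $A\le^1_\omega B$ means there are a partial function $\Gamma:\subseteq\mathbb N^{\mathbb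 N}\to\mathbb N^{\mathbb N}$ with $B\subseteq\mathrm{dom}(\Gamma)$ and $\Gamma(g)\in A$ for all $g\in B$, and a learner $\Psi$ such that for every $g\in\mathrm{dom}(\Gamma)$ the limit $\lim_n\Psi(g\upharpoonright n)$ exists and $\Phi_{\lim_n\Psi(g\upharpoonright n)}(g)=\Gamma(g)$. *)

theory Defs
  imports Complex_Main "HOL-Library.Nat_Bijection" "HOL-Library.Sublist"
begin

section \<open>Oracle computability\<close>

text \<open>
  Kleene's mu-recursive functions relative to an oracle, in the presentation by unary functions
  with the bijective pairing \<^const>\<open>prod_encode\<close>.  \<open>CRec c d\<close> maps \<open>(x, n)\<close> to the \<open>n\<close>-th value of
  the recursion that starts with \<open>c x\<close> and passes from the \<open>k\<close>-th value \<open>v\<close> to \<open>d (x, (k, v))\<close>.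
  \<open>CMin c\<close> maps \<open>x\<close> to the least \<open>n\<close> with \<open>c (x, n) = 0\<close>, where \<open>c (x, m)\<close> has to be defined for
  all \<open>m < n\<close>.
\<close>

datatype code =
    CZero
  | CSucc
  | CFst
  | CSnd
  | COracle
  | CPair code code
  | CComp code code
  | CRec code code
  | CMin code

primrec ev :: "(nat \<Rightarrow> nat) \<Rightarrow> code \<Rightarrow> nat \<Rightarrow> nat option" where
  "ev g CZero = (\<lambda>x. Some 0)"
| "ev g CSucc = (\<lambda>x. Some (Suc x))"
| "ev g CFst = (\<lambda>x. Some (fst (prod_decode x)))"
| "ev g CSnd = (\<lambda>x. Some (snd (prod_decode x)))"
| "ev g COracle = (\<lambda>x. Some (g x))"
| "ev g (CPair c d) =
     (\<lambda>x. Option.bind (ev g c x) (\<lambda>a. Option.bind (ev g d x) (\<lambda>b. Some (prod_encode (a, b)))))"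
| "ev g (CComp c d) = (\<lambda>x. Option.bind (ev g d x) (ev g c))"
| "ev g (CRec c d) =
     (\<lambda>y. case prod_decode y of (x, n) \<Rightarrow>
        rec_nat (ev g c x)
          (\<lambda>k r. Option.bind r (\<lambda>v. ev g d (prod_encode (x, prod_encode (k, v))))) n)"
| "ev g (CMin c) =
     (\<lambda>x. if \<exists>n. ev g c (prod_encode (x, n)) = Some 0 \<and>
                (\<forall>m<n. ev g c (prod_encode (x, m)) \<noteq> None)
          then Some (LEAST n. ev g c (prod_encode (x, n)) = Some 0)
          else None)"

text \<open>An explicit numbering of the programs, bijective by \<open>decode_encode\<close> and \<open>encode_decode\<close>.\<close>

lemma decode_less:
  assumes "e \<noteq> 0"
  shows "(e - 5) div 4 < e"
    and "fst (prod_decode ((e - 5) div 4)) < e"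
    and "snd (prod_decode ((e - 5) div 4)) < e"
proof -
  have le: "fst (prod_decode m) \<le> m" "snd (prod_decode m) \<le> m" for m
    using le_prod_encode_1[of "fst (prod_decode m)" "snd (prod_decode m)"]
      le_prod_encode_2[of "snd (prod_decode m)" "fst (prod_decode m)"] by simp_all
  show "(e - 5) div 4 < e" using assms by linarith
  then show "fst (prod_decode ((e - 5) div 4)) < e" "snd (prod_decode ((e - 5) div 4)) < e"
    using le[of "(e - 5) div 4"] by linarith+
qed

function decode :: "nat \<Rightarrow> code" where
  "decode e =
     (if e = 0 then CZero
      else if e = 1 then CSucc
      else if e = 2 then CFst
      else if e = 3 then CSnd
      else if e = 4 then COracle
      else
        (let m = (e - 5) div 4; r = (e - 5) mod 4;
             i = fst (prod_decode m); j = snd (prod_decode m)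
         in if r = 0 then CPair (decode i) (decode j)
            else if r = 1 then CComp (decode i) (decode j)
            else if r = 2 then CRec (decode i) (decode j)
            else CMin (decode m)))"
  by auto
termination
  by (relation "measure id") (simp_all add: decode_less)

declare decode.simps [simp del]

primrec encode :: "code \<Rightarrow> nat" where
  "encode CZero = 0"
| "encode CSucc = 1"
| "encode CFst = 2"
| "encode CSnd = 3"
| "encode COracle = 4"
| "encode (CPair c d) = 4 * prod_encode (encode c, encode d) + 5"
| "encode (CComp c d) = 4 * prod_encode (encode c, encode d) + 6"
| "encode (CRec c d) = 4 * prod_encode (encode c, encode d) + 7"
| "encode (CMin c) = 4 * encode c + 8"

lemma decode_base:
  "decode 0 = CZero" "decode 1 = CSucc" "decode 2 = CFst" "decode 3 = CSnd" "decode 4 = COracle"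
  by (subst decode.simps, simp)+

lemma decode_step:
  assumes "r < 4"
  shows "decode (4 * m + r + 5) =
    (if r = 0 then CPair (decode (fst (prod_decode m))) (decode (snd (prod_decode m)))
     else if r = 1 then CComp (decode (fst (prod_decode m))) (decode (snd (prod_decode m)))
     else if r = 2 then CRec (decode (fst (prod_decode m))) (decode (snd (prod_decode m)))
     else CMin (decode m))"
proof -
  have "(4 * m + r + 5 - 5) div 4 = m" "(4 * m + r + 5 - 5) mod 4 = r"
    using assms by simp_all
  moreover have "4 * m + r + 5 \<noteq> 0" "4 * m + r + 5 \<noteq> 1" "4 * m + r + 5 \<noteq> 2"
    "4 * m + r + 5 \<noteq> 3" "4 * m + r + 5 \<noteq> 4" by linarith+
  ultimately show ?thesis
    by (subst decode.simps) (simp only: Let_def if_False)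
qed

lemma decode_encode: "decode (encode c) = c"
proof (induction c)
  case (CPair c d)
  with decode_step[of 0 "prod_encode (encode c, encode d)"] show ?case by simp
next
  case (CComp c d)
  with decode_step[of 1 "prod_encode (encode c, encode d)"] show ?case by (simp add: add.commute)
next
  case (CRec c d)
  with decode_step[of 2 "prod_encode (encode c, encode d)"] show ?case by (simp add: add.commute)
next
  case (CMin c)
  with decode_step[of 3 "encode c"] show ?case by (simp add: add.commute)
qed (simp_all only: encode.simps decode_base)

lemma encode_decode: "encode (decode e) = e"
proof (induction e rule: less_induct)
  case (less e)
  show ?case
  proof (cases "e < 5")
    case True
    then have "e = 0 \<or> e = 1 \<or> e = 2 \<or> e = 3 \<or> e = 4" by linarith
    then show ?thesis by (elim disjE) (simp_all only: decode_base encode.simps)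
  next
    case False
    define m where "m = (e - 5) div 4"
    define r where "r = (e - 5) mod 4"
    have e: "e = 4 * m + r + 5" and "r < 4"
      using False by (simp_all add: m_def r_def)
    have IH: "encode (decode (fst (prod_decode m))) = fst (prod_decode m)"
      "encode (decode (snd (prod_decode m))) = snd (prod_decode m)"
      "encode (decode m) = m"
      using less decode_less[of e] False by (simp_all add: m_def)
    have "r = 0 \<or> r = 1 \<or> r = 2 \<or> r = 3" using \<open>r < 4\<close> by linarith
    then have "encode (decode (4 * m + r + 5)) = 4 * m + r + 5"
      unfolding decode_step[OF \<open>r < 4\<close>] using IH by auto
    with e show ?thesis by simp
  qed
qed

text \<open>
  The effective enumeration of the partial computable functions on Baire space:
  \<open>\<Phi>\<^sub>e(g)\<close> is defined iff the \<open>e\<close>-th program with oracle \<open>g\<close> halts on every input.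
\<close>

definition Phi :: "nat \<Rightarrow> (nat \<Rightarrow> nat) \<rightharpoonup> (nat \<Rightarrow> nat)" where
  "Phi e g =
     (if \<forall>n. ev g (decode e) n \<noteq> None then Some (\<lambda>n. the (ev g (decode e) n)) else None)"

definition computable :: "(nat \<Rightarrow> nat) \<Rightarrow> bool" where
  "computable f \<longleftrightarrow> (\<exists>c. \<forall>n. ev (\<lambda>_. 0) c n = Some (f n))"

definition computable_list_fun :: "(nat list \<Rightarrow> nat) \<Rightarrow> bool" where
  "computable_list_fun \<psi> \<longleftrightarrow> computable (\<lambda>n. \<psi> (list_decode n))"

section \<open>Trees and \<open>\<Pi>\<^sup>0\<^sub>1\<close> subsets of Cantor space\<close>

text \<open>
  Cantor space is the set of the 0-1-valued members of \<^typ>\<open>nat \<Rightarrow> nat\<close>.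
\<close>

definition restr :: "(nat \<Rightarrow> nat) \<Rightarrow> nat \<Rightarrow> nat list" where
  "restr f n = map f [0..<n]"

definition paths :: "nat list set \<Rightarrow> (nat \<Rightarrow> nat) set" where
  "paths T = {f. \<forall>n. restr f n \<in> T}"

definition binary_tree :: "nat list set \<Rightarrow> bool" where
  "binary_tree T \<longleftrightarrow>
     (\<forall>\<sigma>\<in>T. set \<sigma> \<subseteq> {0, 1}) \<and> (\<forall>\<sigma>\<in>T. \<forall>\<tau>. prefix \<tau> \<sigma> \<longrightarrow> \<tau> \<in> T)"

definition computable_tree :: "nat list set \<Rightarrow> bool" where
  "computable_tree T \<longleftrightarrow>
     binary_tree T \<and> computable_list_fun (\<lambda>\<sigma>. if \<sigma> \<in> T then 1 else 0)"

definition pi01_class :: "(nat \<Rightarrow> nat) set \<Rightarrow> bool" where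
  "pi01_class P \<longleftrightarrow> (\<exists>T. computable_tree T \<and> paths T = P)"

definition leaves :: "nat list set \<Rightarrow> nat list set" where
  "leaves T = {\<sigma> \<in> T. \<forall>\<tau>\<in>T. \<not> strict_prefix \<sigma> \<tau>}"

definition special :: "(nat \<Rightarrow> nat) set \<Rightarrow> bool" where
  "special A \<longleftrightarrow> A \<noteq> {} \<and> (\<forall>f\<in>A. \<not> computable f)"

section \<open>Hyperconcatenation and join products\<close>

text \<open>
  \<open>interleave [\<rho>\<^sub>0, \<dots>] \<tau>\<close> is the string \<open>\<rho>\<^sub>0 \<langle>\<tau>(0)\<rangle> \<rho>\<^sub>1 \<langle>\<tau>(1)\<rangle> \<dots>\<close>.
\<close>

definition interleave :: "nat list list \<Rightarrow> nat list \<Rightarrow> nat list" where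
  "interleave \<rho>s \<tau> = concat (map2 (\<lambda>\<rho> a. \<rho> @ [a]) \<rho>s \<tau>)"

definition hyperconcat_tree :: "nat list set \<Rightarrow> nat list set \<Rightarrow> nat list set" where
  "hyperconcat_tree TQ TP =
     {\<eta>. \<exists>\<tau>\<in>TQ. \<exists>\<rho>s. \<exists>\<sigma>\<in>TP. length \<rho>s = length \<tau> \<and> set \<rho>s \<subseteq> leaves TP \<and>
          prefix \<eta> (interleave \<rho>s \<tau> @ \<sigma>)}"

text \<open>
  As a set, the hyperconcatenation depends on the trees chosen for the two \<open>\<Pi>\<^sup>0\<^sub>1\<close> sets, so it is a
  function of these trees.
\<close>

definition hyperconcat :: "nat list set \<Rightarrow> nat list set \<Rightarrow> (nat \<Rightarrow> nat) set" where
  "hyperconcat TQ TP = paths (hyperconcat_tree TQ TP)"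

definition join :: "(nat \<Rightarrow> nat) \<Rightarrow> (nat \<Rightarrow> nat) \<Rightarrow> nat \<Rightarrow> nat" where
  "join f g = (\<lambda>k. if even k then f (k div 2) else g (k div 2))"

definition join_prod :: "(nat \<Rightarrow> nat) set \<Rightarrow> (nat \<Rightarrow> nat) set \<Rightarrow> (nat \<Rightarrow> nat) set" where
  "join_prod A B = {join f g | f g. f \<in> A \<and> g \<in> B}"

section \<open>Learner reducibility\<close>

definition learner :: "(nat list \<Rightarrow> nat) \<Rightarrow> bool" where
  "learner \<Psi> \<longleftrightarrow> computable_list_fun \<Psi>"

text \<open>
  Convergence refers to the order topology of \<^typ>\<open>nat\<close>, which is discrete.
\<close>

definition learnable_via :: "((nat \<Rightarrow> nat) \<rightharpoonup> (nat \<Rightarrow> nat)) \<Rightarrow> (nat list \<Rightarrow> nat) \<Rightarrow> bool" where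
  "learnable_via \<Gamma> \<Psi> \<longleftrightarrow>
     (\<forall>g\<in>dom \<Gamma>. convergent (\<lambda>n. \<Psi> (restr g n)) \<and> Phi (lim (\<lambda>n. \<Psi> (restr g n))) g = \<Gamma> g)"

definition learn_reducible :: "(nat \<Rightarrow> nat) set \<Rightarrow> (nat \<Rightarrow> nat) set \<Rightarrow> bool" where
  "learn_reducible A B \<longleftrightarrow>
     (\<exists>\<Gamma> \<Psi>. B \<subseteq> dom \<Gamma> \<and> (\<forall>g\<in>B. the (\<Gamma> g) \<in> A) \<and> learner \<Psi> \<and> learnable_via \<Gamma> \<Psi>)"

end

theory Submission
  imports Defs
begin

text \<open>
  Fix \<open>g \<in> R\<close>.  A position is a string \<open>u = \<rho>\<^sub>0 \<tau>(0) \<dots> \<rho>\<^bsub>n-1\<^esub> \<tau>(n-1)\<close> with a bit \<open>a\<close> such that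
  \<open>\<tau>\<^sup>\<frown>a \<in> T\<^sub>Q\<close>; call it stable if the given learner, fed with \<open>g\<close> on the other side, does not change
  its mind above \<open>u\<close> before a second further leaf of \<open>T\<^sub>P\<close> is passed.  Stable positions exist, since
  otherwise infinitely many mind changes could be arranged along a path of \<open>T\<^sub>Q\<close>.  Instability is
  witnessed by finitely much of \<open>g\<close>, so a learner finds the least stable position in the limit.

  At a stable position with guess \<open>e\<close>, every leaf \<open>\<rho>\<close> of \<open>T\<^sub>P\<close> gives a map \<open>F\<^sub>\<rho> : P \<rightarrow> P\<close>,
  \<open>F\<^sub>\<rho>(h) = \<Phi>\<^sub>e(u \<rho> a h \<oplus> g)\<close>.  If \<open>h \<in> P\<close>, then \<open>F\<^bsub>\<rho>\<^sub>1\<^esub> \<dots> F\<^bsub>\<rho>\<^sub>k\<^esub> (\<Phi>\<^sub>e(u h \<oplus> g))\<close> is total, so a leaf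
  \<open>\<rho>\<^bsub>k+1\<^esub>\<close> above a long initial segment of \<open>h\<close> makes \<open>F\<^bsub>\<rho>\<^sub>1\<^esub> \<dots> F\<^bsub>\<rho>\<^bsub>k+1\<^esub>\<^esub>\<close> produce \<open>k + 1\<close> values on
  the empty input.  Searching for such leaves one after the other computes from \<open>g\<close> a limit
  \<open>F\<^bsub>\<rho>\<^sub>1\<^esub> (F\<^bsub>\<rho>\<^sub>2\<^esub> (\<dots>))\<close>, which lies in the closed set \<open>P\<close>.
\<close>

section \<open>Uniformly computable functionals\<close>

abbreviation pfst :: "nat \<Rightarrow> nat" where "pfst z \<equiv> fst (prod_decode z)"
abbreviation psnd :: "nat \<Rightarrow> nat" where "psnd z \<equiv> snd (prod_decode z)"

text \<open>One program has to halt everywhere and for every oracle. This totality lets the closure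
  rules in \<open>comp_intros\<close> compose without side conditions and gives machines uniform in
  \<open>g\<close>.\<close>

definition comp_fun :: "((nat \<Rightarrow> nat) \<Rightarrow> nat \<Rightarrow> nat) \<Rightarrow> bool" where
  "comp_fun F \<longleftrightarrow> (\<exists>c. \<forall>g x. ev g c x = Some (F g x))"

definition comp_pred :: "((nat \<Rightarrow> nat) \<Rightarrow> nat \<Rightarrow> bool) \<Rightarrow> bool" where
  "comp_pred R \<longleftrightarrow> comp_fun (\<lambda>g x. if R g x then 1 else 0)"

definition comp_list :: "((nat \<Rightarrow> nat) \<Rightarrow> nat \<Rightarrow> nat list) \<Rightarrow> bool" where
  "comp_list A \<longleftrightarrow> comp_fun (\<lambda>g x. list_encode (A g x))"

named_theorems comp_intros

lemma comp_fun_id [comp_intros]: "comp_fun (\<lambda>g x. x)"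
  \<comment> \<open>\<open>code\<close> has no identity constructor; re-pairing the two projections
    is the identity because the pairing is bijective.\<close>
  unfolding comp_fun_def by (rule exI[of _ "CPair CFst CSnd"]) simp

lemma comp_fun_comp:
  assumes "comp_fun F" "comp_fun A"
  shows "comp_fun (\<lambda>g x. F g (A g x))"
proof -
  obtain c d where "\<forall>g x. ev g c x = Some (F g x)" "\<forall>g x. ev g d x = Some (A g x)"
    using assms unfolding comp_fun_def by blast
  then show ?thesis unfolding comp_fun_def by (intro exI[of _ "CComp c d"]) simp
qed

lemma comp_fun_Suc [comp_intros]: "comp_fun A \<Longrightarrow> comp_fun (\<lambda>g x. Suc (A g x))"
  by (rule comp_fun_comp[of "\<lambda>g x. Suc x"]) (auto simp: comp_fun_def intro: exI[of _ CSucc])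

lemma comp_fun_pfst [comp_intros]: "comp_fun A \<Longrightarrow> comp_fun (\<lambda>g x. pfst (A g x))"
  by (rule comp_fun_comp[of "\<lambda>g x. pfst x"]) (auto simp: comp_fun_def intro: exI[of _ CFst])

lemma comp_fun_psnd [comp_intros]: "comp_fun A \<Longrightarrow> comp_fun (\<lambda>g x. psnd (A g x))"
  by (rule comp_fun_comp[of "\<lambda>g x. psnd x"]) (auto simp: comp_fun_def intro: exI[of _ CSnd])

lemma comp_fun_oracle [comp_intros]: "comp_fun A \<Longrightarrow> comp_fun (\<lambda>g x. g (A g x))"
  by (rule comp_fun_comp[of "\<lambda>g x. g x"]) (auto simp: comp_fun_def intro: exI[of _ COracle])

lemma comp_fun_const [comp_intros]: "comp_fun (\<lambda>g x. k)"
proof (induction k)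
  case 0
  show ?case unfolding comp_fun_def by (rule exI[of _ CZero]) simp
qed (rule comp_fun_Suc)

lemma comp_fun_pair [comp_intros]:
  assumes "comp_fun A" "comp_fun B"
  shows "comp_fun (\<lambda>g x. prod_encode (A g x, B g x))"
proof -
  obtain c d where "\<forall>g x. ev g c x = Some (A g x)" "\<forall>g x. ev g d x = Some (B g x)"
    using assms unfolding comp_fun_def by blast
  then show ?thesis unfolding comp_fun_def by (intro exI[of _ "CPair c d"]) simp
qed

lemma comp_fun_rec [comp_intros]:
  assumes "comp_fun A" "comp_fun (\<lambda>g z. D g (pfst z) (pfst (psnd z)) (psnd (psnd z)))" "comp_fun N"
  shows "comp_fun (\<lambda>g x. rec_nat (A g x) (D g x) (N g x))"
proof -
  obtain c d where c: "\<And>g x. ev g c x = Some (A g x)"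
    and d: "\<And>g z. ev g d z = Some (D g (pfst z) (pfst (psnd z)) (psnd (psnd z)))"
    using assms(1,2) unfolding comp_fun_def by blast
  have "rec_nat (ev g c x)
      (\<lambda>k r. Option.bind r (\<lambda>v. ev g d (prod_encode (x, prod_encode (k, v))))) n
    = Some (rec_nat (A g x) (D g x) n)" for g x n
    by (induction n) (simp_all add: c d)
  then have "comp_fun (\<lambda>g z. rec_nat (A g (pfst z)) (D g (pfst z)) (psnd z))"
    unfolding comp_fun_def by (intro exI[of _ "CRec c d"]) (simp add: split_beta)
  from comp_fun_comp[OF this comp_fun_pair[OF comp_fun_id assms(3)]] show ?thesis by simp
qed

section \<open>Arithmetic, decidable predicates and bounded search\<close>

lemma comp_fun_plus [comp_intros]:
  assumes "comp_fun A" "comp_fun B" shows "comp_fun (\<lambda>g x. A g x + B g x)"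
proof -
  have "rec_nat a (\<lambda>_ v. Suc v) b = a + b" for a b by (induction b) auto
  moreover have "comp_fun (\<lambda>g x. rec_nat (A g x) (\<lambda>_ v. Suc v) (B g x))"
    by (intro comp_intros assms)
  ultimately show ?thesis by simp
qed

lemma comp_fun_minus [comp_intros]:
  assumes "comp_fun A" "comp_fun B" shows "comp_fun (\<lambda>g x. A g x - B g x)"
proof -
  have "rec_nat 0 (\<lambda>k _. k) a = a - 1" for a by (induction a) auto
  then have pred: "comp_fun (\<lambda>g x. F g x - 1)" if "comp_fun F" for F
    using comp_fun_rec[OF comp_fun_const[of 0] _ that, of "\<lambda>g x k _. k"]
      comp_fun_pfst[OF comp_fun_psnd[OF comp_fun_id]] by simp
  have "rec_nat a (\<lambda>_ v. v - 1) b = a - b" for a b by (induction b) auto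
  moreover have "comp_fun (\<lambda>g x. rec_nat (A g x) (\<lambda>_ v. v - 1) (B g x))"
    by (intro comp_intros pred assms)
  ultimately show ?thesis by simp
qed

lemma comp_fun_times [comp_intros]:
  assumes "comp_fun A" "comp_fun B" shows "comp_fun (\<lambda>g x. A g x * B g x)"
proof -
  have "rec_nat 0 (\<lambda>_ v. v + a) b = a * b" for a b by (induction b) auto
  moreover have "comp_fun (\<lambda>g x. rec_nat 0 (\<lambda>_ v. v + A g x) (B g x))"
    by (intro comp_intros assms comp_fun_comp[OF assms(1)])
  ultimately show ?thesis by simp
qed

lemma comp_pred_comp:
  assumes "comp_pred R" "comp_fun A" shows "comp_pred (\<lambda>g x. R g (A g x))"
  using assms comp_fun_comp unfolding comp_pred_def by fast

lemma comp_fun_if [comp_intros]: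
  assumes "comp_pred R" "comp_fun A" "comp_fun B"
  shows "comp_fun (\<lambda>g x. if R g x then A g x else B g x)"
proof -
  have "comp_fun (\<lambda>g x. rec_nat (B g x) (\<lambda>_ _. A g x) (if R g x then 1 else 0))"
    by (intro comp_fun_rec comp_fun_comp[OF assms(2)] comp_intros assms assms(1)[unfolded comp_pred_def])
  moreover have "rec_nat b (\<lambda>_ _. a) (if r then 1 else 0) = (if r then a else b)" for a b :: nat and r
    by simp
  ultimately show ?thesis by simp
qed

lemma comp_pred_not [comp_intros]:
  assumes "comp_pred R" shows "comp_pred (\<lambda>g x. \<not> R g x)"
proof -
  have "(if \<not> r then 1 else 0) = (if r then 0 else (1::nat))" for r by simp
  then show ?thesis unfolding comp_pred_def by (simp only:) (intro comp_intros assms)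
qed

lemma comp_pred_conj [comp_intros]:
  assumes "comp_pred R" "comp_pred S" shows "comp_pred (\<lambda>g x. R g x \<and> S g x)"
proof -
  have "(if r \<and> s then 1 else 0) = (if r then if s then 1 else 0 else (0::nat))" for r s by simp
  then show ?thesis unfolding comp_pred_def by (simp only:) (intro comp_intros assms)
qed

lemma comp_pred_disj [comp_intros]:
  assumes "comp_pred R" "comp_pred S" shows "comp_pred (\<lambda>g x. R g x \<or> S g x)"
  using comp_pred_not[OF comp_pred_conj[OF comp_pred_not[OF assms(1)] comp_pred_not[OF assms(2)]]]
  by simp

lemma comp_pred_less [comp_intros]:
  assumes "comp_fun A" "comp_fun B" shows "comp_pred (\<lambda>g x. A g x < B g x)"
proof -
  have "(if a < b then 1 else 0) = 1 - (1 - (b - a))" for a b :: nat by simp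
  then show ?thesis unfolding comp_pred_def by (simp only:) (intro comp_intros assms)
qed

lemma comp_pred_le [comp_intros]:
  assumes "comp_fun A" "comp_fun B" shows "comp_pred (\<lambda>g x. A g x \<le> B g x)"
  using comp_pred_not[OF comp_pred_less[OF assms(2,1)]] by (simp add: not_less)

lemma comp_pred_eq [comp_intros]:
  assumes "comp_fun A" "comp_fun B" shows "comp_pred (\<lambda>g x. A g x = B g x)"
  using comp_pred_conj[OF comp_pred_le[OF assms] comp_pred_le[OF assms(2,1)]]
  by (simp add: eq_iff)

lemma comp_pred_ex [comp_intros]:
  assumes "comp_fun N" "comp_pred (\<lambda>g z. R g (pfst z) (psnd z))"
  shows "comp_pred (\<lambda>g x. \<exists>y<N g x. R g x y)"
proof -
  have R: "comp_pred (\<lambda>g z. R g (A g z) (B g z))" if "comp_fun A" "comp_fun B" for A B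
    using comp_pred_comp[OF assms(2) comp_fun_pair[OF that]] by simp
  have "rec_nat 0 (\<lambda>k v. if r k then 1 else v) n = (if \<exists>y<n. r y then 1 else (0::nat))" for r n
    by (induction n) (auto simp: less_Suc_eq)
  moreover have "comp_fun (\<lambda>g x. rec_nat 0 (\<lambda>k v. if R g x k then 1 else v) (N g x))"
    by (intro comp_intros R assms)
  ultimately show ?thesis unfolding comp_pred_def by simp
qed

lemma comp_pred_all [comp_intros]:
  assumes "comp_fun N" "comp_pred (\<lambda>g z. R g (pfst z) (psnd z))"
  shows "comp_pred (\<lambda>g x. \<forall>y<N g x. R g x y)"
  using comp_pred_not[OF comp_pred_ex[OF assms(1) comp_pred_not[OF assms(2)]]] by simp

text \<open>The disjunct \<open>y = N g x\<close> makes the bound the default answer when no smaller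
  \<open>y\<close> satisfies \<open>R\<close>, so the search is total.\<close>

lemma comp_fun_bounded_Least:
  assumes "comp_fun N" "comp_pred (\<lambda>g z. R g (pfst z) (psnd z))"
  shows "comp_fun (\<lambda>g x. LEAST y. y = N g x \<or> R g x y)"
proof -
  have R: "comp_pred (\<lambda>g z. R g (A g z) (B g z))" if "comp_fun A" "comp_fun B" for A B
    using comp_pred_comp[OF assms(2) comp_fun_pair[OF that]] by simp
  \<comment> \<open>As long as \<open>v = n\<close>, nothing has been found among the candidates
    inspected so far.\<close>
  have *: "rec_nat n (\<lambda>k v. if v = n \<and> r k then k else v) m =
      (LEAST y. y = n \<or> y < m \<and> r y)" if "m \<le> n" for n m and r :: "nat \<Rightarrow> bool"
    using that
  proof (induction m)
    case 0
    then show ?case by (simp add: Least_equality)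
  next
    case (Suc m)
    let ?l = "LEAST y. y = n \<or> y < m \<and> r y"
    have l: "?l = n \<or> ?l < m \<and> r ?l" by (rule LeastI[of _ n]) simp
    have le: "?l \<le> y" if "y = n \<or> y < m \<and> r y" for y using that by (rule Least_le)
    show ?case
    proof (cases "?l = n \<and> r m")
      case True
      then have "(LEAST y. y = n \<or> y < Suc m \<and> r y) = m"
        using le[of y for y] Suc.prems
        by (intro Least_equality) (auto simp: less_Suc_eq, metis leD less_trans Suc_le_lessD)
      then show ?thesis using Suc True by simp
    next
      case False
      have "(LEAST y. y = n \<or> y < Suc m \<and> r y) = ?l"
        using l le Suc.prems False by (intro Least_equality) (auto simp: less_Suc_eq)
      then show ?thesis using Suc False by auto
    qed
  qed
  have "(LEAST y. y = n \<or> y < n \<and> r y) = (LEAST y. y = n \<or> r y)" for n and r :: "nat \<Rightarrow> bool"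
  proof (rule Least_equality[symmetric])
    let ?l = "LEAST y. y = n \<or> y < n \<and> r y"
    have "?l = n \<or> ?l < n \<and> r ?l" by (rule LeastI[of _ n]) simp
    then show "?l = n \<or> r ?l" by auto
    show "?l \<le> y" if "y = n \<or> r y" for y
      using that by (cases "y < n") (auto intro: Least_le order_trans[OF Least_le[of _ n]])
  qed
  with * have "rec_nat n (\<lambda>k v. if v = n \<and> r k then k else v) n = (LEAST y. y = n \<or> r y)" for n r
    by simp
  moreover have "comp_fun (\<lambda>g x. rec_nat (N g x) (\<lambda>k v. if v = N g x \<and> R g x k then k else v) (N g x))"
    by (intro comp_intros R assms comp_fun_comp[OF assms(1)])
  ultimately show ?thesis by simp
qed

lemma comp_fun_div:
  assumes "comp_fun A" "0 < k" shows "comp_fun (\<lambda>g x. A g x div k)"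
proof -
  have "(LEAST q. q = a \<or> a < k * Suc q) = a div k" for a
  proof (rule Least_equality)
    show "a div k = a \<or> a < k * Suc (a div k)"
      using dividend_less_times_div[OF assms(2), of a] by simp
    fix q assume "q = a \<or> a < k * Suc q"
    then show "a div k \<le> q" using assms(2)
      by (metis div_le_dividend less_mult_imp_div_less less_Suc_eq_le mult.commute)
  qed
  moreover have "comp_fun (\<lambda>g x. LEAST q. q = A g x \<or> A g x < k * Suc q)"
    by (intro comp_fun_bounded_Least comp_intros assms comp_fun_comp[OF assms(1)])
  ultimately show ?thesis by simp
qed

lemma comp_fun_mod:
  assumes "comp_fun A" "0 < k" shows "comp_fun (\<lambda>g x. A g x mod k)"
proof -
  have "comp_fun (\<lambda>g x. A g x - k * (A g x div k))"
    by (intro comp_intros comp_fun_div assms)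
  then show ?thesis by (simp add: minus_mult_div_eq_mod)
qed

lemma comp_fun_div_mod_numeral [comp_intros]:
  assumes "comp_fun A"
  shows "comp_fun (\<lambda>g x. A g x div numeral k)" "comp_fun (\<lambda>g x. A g x mod numeral k)"
  by (intro comp_fun_div comp_fun_mod assms, simp)+

lemma comp_pred_even [comp_intros]: "comp_fun A \<Longrightarrow> comp_pred (\<lambda>g x. even (A g x))"
  unfolding even_iff_mod_2_eq_zero by (intro comp_intros)

subsection \<open>Lists\<close>

text \<open>Outside the list the value is 0; access becomes total, and a string can be used as an
  oracle function.\<close>

definition nth0 :: "nat list \<Rightarrow> nat \<Rightarrow> nat" where
  "nth0 xs i = (if i < length xs then xs ! i else 0)"

lemma comp_list_decode [comp_intros]: "comp_fun A \<Longrightarrow> comp_list (\<lambda>g x. list_decode (A g x))"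
  unfolding comp_list_def by simp

lemma comp_list_encode [comp_intros]: "comp_list A \<Longrightarrow> comp_fun (\<lambda>g x. list_encode (A g x))"
  unfolding comp_list_def .

lemma prod_decode_0: "prod_decode 0 = (0, 0)"
  using prod_encode_inverse[of "(0, 0)"] by (simp add: prod_encode_def)

lemma list_encode_tl: "list_encode (tl xs) = psnd (list_encode xs - 1)"
  by (cases xs) (simp_all add: prod_decode_0)

lemma list_encode_eq_0_iff: "list_encode xs = 0 \<longleftrightarrow> xs = []"
  by (cases xs) simp_all

lemma comp_list_drop [comp_intros]:
  assumes "comp_list A" "comp_fun B" shows "comp_list (\<lambda>g x. drop (B g x) (A g x))"
proof -
  \<comment> \<open>\<open>psnd (v - 1)\<close> acts as \<open>tl\<close> on codes; the code 0 of
    the empty list is mapped to itself.\<close>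
  have "rec_nat (list_encode xs) (\<lambda>_ v. psnd (v - 1)) n = list_encode (drop n xs)" for xs n
    by (induction n) (simp_all add: list_encode_tl drop_Suc tl_drop[symmetric])
  moreover have "comp_fun (\<lambda>g x. rec_nat (list_encode (A g x)) (\<lambda>_ v. psnd (v - 1)) (B g x))"
    by (intro comp_intros assms)
  ultimately show ?thesis unfolding comp_list_def by simp
qed

lemma comp_fun_nth0 [comp_intros]:
  assumes "comp_list A" "comp_fun B" shows "comp_fun (\<lambda>g x. nth0 (A g x) (B g x))"
proof -
  have "nth0 xs i = pfst (list_encode (drop i xs) - 1)" for xs i
  proof (cases "i < length xs")
    case True
    then show ?thesis by (simp add: nth0_def Cons_nth_drop_Suc[symmetric])
  next
    case False
    then show ?thesis by (simp add: nth0_def prod_decode_0)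
  qed
  moreover have "comp_fun (\<lambda>g x. pfst (list_encode (drop (B g x) (A g x)) - 1))"
    by (intro comp_intros assms)
  ultimately show ?thesis by simp
qed

lemma length_le_list_encode: "length xs \<le> list_encode xs"
proof (induction xs)
  case (Cons x xs)
  then show ?case using le_prod_encode_2[of "list_encode xs" x] by simp
qed simp

lemma comp_fun_length [comp_intros]:
  assumes "comp_list A" shows "comp_fun (\<lambda>g x. length (A g x))"
proof -
  have "(LEAST i. i = list_encode xs \<or> list_encode (drop i xs) = 0) = length xs" for xs
    using length_le_list_encode[of xs]
    by (intro Least_equality) (auto simp: list_encode_eq_0_iff)
  moreover have "comp_fun (\<lambda>g x. LEAST i. i = list_encode (A g x) \<or>
      list_encode (drop i (A g x)) = 0)"
    using comp_fun_comp[OF assms[unfolded comp_list_def] comp_fun_pfst[OF comp_fun_id]]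
    by (intro comp_fun_bounded_Least comp_intros assms) (simp add: comp_list_def)
  ultimately show ?thesis by simp
qed

lemma comp_list_map_upt [comp_intros]:
  assumes "comp_fun (\<lambda>g z. F g (pfst z) (psnd z))" "comp_fun N"
  shows "comp_list (\<lambda>g x. map (F g x) [0..<N g x])"
proof -
  have F: "comp_fun (\<lambda>g z. F g (A g z) (B g z))" if "comp_fun A" "comp_fun B" for A B
    using comp_fun_comp[OF assms(1) comp_fun_pair[OF that]] by simp
  have *: "k \<le> n \<Longrightarrow> rec_nat 0 (\<lambda>k v. Suc (prod_encode (f (n - Suc k), v))) k
    = list_encode (map f [n - k..<n])" for f n k
  proof (induction k)
    case (Suc k)
    have "[n - Suc k..<n] = (n - Suc k) # [n - k..<n]"
      using Suc.prems by (simp add: upt_conv_Cons Suc_diff_Suc)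
    with Suc show ?case by simp
  qed simp
  have "comp_fun (\<lambda>g x. rec_nat 0 (\<lambda>k v. Suc (prod_encode (F g x (N g x - Suc k), v))) (N g x))"
    by (intro comp_intros F assms comp_fun_comp[OF assms(2)])
  then show ?thesis unfolding comp_list_def using * by simp
qed

text \<open>Under a bounded quantifier or a \<open>map\<close> the argument is a pair of the outer
  argument and the bound variable; this carries a hypothesis on the outer argument there.\<close>

lemma comp_list_pfst:
  assumes "comp_list A" shows "comp_list (\<lambda>g x. A g (pfst x))"
  using comp_fun_comp[OF assms[unfolded comp_list_def] comp_fun_pfst[OF comp_fun_id]]
  by (simp add: comp_list_def)

lemma comp_list_append [comp_intros]:
  assumes "comp_list A" "comp_list B" shows "comp_list (\<lambda>g x. A g x @ B g x)"
proof -
  have *: "xs @ ys = map (\<lambda>i. if i < length xs then nth0 xs i else nth0 ys (i - length xs))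
      [0..<length xs + length ys]" for xs ys
    by (rule nth_equalityI) (auto simp: nth_append nth0_def)
  show ?thesis unfolding * by (intro comp_intros comp_list_pfst assms)
qed

lemma comp_list_Nil [comp_intros]: "comp_list (\<lambda>g x. [])"
  unfolding comp_list_def by (intro comp_intros)

lemma comp_list_Cons [comp_intros]:
  assumes "comp_fun A" "comp_list B" shows "comp_list (\<lambda>g x. A g x # B g x)"
  unfolding comp_list_def list_encode.simps
  by (intro comp_intros assms)

lemma comp_list_take [comp_intros]:
  assumes "comp_list A" "comp_fun B" shows "comp_list (\<lambda>g x. take (B g x) (A g x))"
proof -
  have *: "take n xs = map (nth0 xs) [0..<if n < length xs then n else length xs]" for n xs
    by (rule nth_equalityI) (auto simp: nth0_def)
  show ?thesis unfolding * by (intro comp_intros comp_list_pfst assms)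
qed

lemma comp_pred_Bex_set [comp_intros]:
  assumes "comp_list A" "comp_pred (\<lambda>g z. R g (pfst z) (psnd z))"
  shows "comp_pred (\<lambda>g x. \<exists>t\<in>set (A g x). R g x t)"
proof -
  have nth: "comp_pred (\<lambda>g z. R g (pfst z) (nth0 (A g (pfst z)) (psnd z)))"
    using comp_pred_comp[OF assms(2) comp_fun_pair[OF comp_fun_pfst[OF comp_fun_id]
      comp_fun_nth0[OF comp_list_pfst[OF assms(1)] comp_fun_psnd[OF comp_fun_id]]]] by simp
  have *: "(\<exists>t\<in>set xs. r t) \<longleftrightarrow> (\<exists>i<length xs. r (nth0 xs i))" for xs r
    unfolding Bex_def in_set_conv_nth nth0_def by (metis (full_types))
  show ?thesis unfolding * by (rule comp_pred_ex[OF comp_fun_length[OF assms(1)] nth])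
qed

lemma comp_pred_in_set [comp_intros]:
  assumes "comp_list A" "comp_fun B" shows "comp_pred (\<lambda>g x. B g x \<in> set (A g x))"
proof -
  have "comp_pred (\<lambda>g x. \<exists>t\<in>set (A g x). t = B g x)"
    by (intro comp_intros assms comp_fun_comp[OF assms(2)])
  then show ?thesis by simp
qed


section \<open>Derivations as a universal machine\<close>

abbreviation entry :: "nat \<Rightarrow> nat \<Rightarrow> nat \<Rightarrow> nat" where
  "entry e x y \<equiv> prod_encode (e, prod_encode (x, y))"

text \<open>
  An entry \<open>\<langle>e, x, y\<rangle>\<close> claims that program \<open>e\<close> maps \<open>x\<close> to \<open>y\<close>.  In a derivation each entry follows
  from later ones, with an oracle known only on the string \<open>w\<close>; the cases follow \<^const>\<open>decode\<close>.
\<close>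

definition eval_step :: "nat list \<Rightarrow> nat list \<Rightarrow> nat \<Rightarrow> nat \<Rightarrow> nat \<Rightarrow> bool" where
  "eval_step w L e x y \<longleftrightarrow>
     (e = 0 \<and> y = 0) \<or> (e = 1 \<and> y = Suc x) \<or> (e = 2 \<and> y = pfst x) \<or> (e = 3 \<and> y = psnd x) \<or>
     (e = 4 \<and> x < length w \<and> y = nth0 w x) \<or>
     (5 \<le> e \<and> (e - 5) mod 4 = 0 \<and>
        entry (pfst ((e - 5) div 4)) x (pfst y) \<in> set L \<and>
        entry (psnd ((e - 5) div 4)) x (psnd y) \<in> set L) \<or>
     (5 \<le> e \<and> (e - 5) mod 4 = 1 \<and>
        (\<exists>t\<in>set L. pfst t = psnd ((e - 5) div 4) \<and> pfst (psnd t) = x \<and>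
           entry (pfst ((e - 5) div 4)) (psnd (psnd t)) y \<in> set L)) \<or>
     (5 \<le> e \<and> (e - 5) mod 4 = 2 \<and> psnd x = 0 \<and>
        entry (pfst ((e - 5) div 4)) (pfst x) y \<in> set L) \<or>
     (5 \<le> e \<and> (e - 5) mod 4 = 2 \<and> 0 < psnd x \<and>
        (\<exists>t\<in>set L. pfst t = e \<and> pfst (psnd t) = prod_encode (pfst x, psnd x - 1) \<and>
           entry (psnd ((e - 5) div 4))
             (prod_encode (pfst x, prod_encode (psnd x - 1, psnd (psnd t)))) y \<in> set L)) \<or>
     (5 \<le> e \<and> (e - 5) mod 4 = 3 \<and>
        entry ((e - 5) div 4) (prod_encode (x, y)) 0 \<in> set L \<and>
        (\<forall>k<y. \<exists>t\<in>set L. pfst t = (e - 5) div 4 \<and> pfst (psnd t) = prod_encode (x, k) \<and>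
           0 < psnd (psnd t)))"

text \<open>\<open>eval_step\<close> reads an unknown intermediate value off a member of
  \<open>L\<close>, which keeps its quantifiers bounded; this equivalence restores the quantifier
  over the value.\<close>

lemma Bex_entry:
  "(\<exists>t\<in>A. pfst t = a \<and> pfst (psnd t) = b \<and> R (psnd (psnd t))) \<longleftrightarrow> (\<exists>z. entry a b z \<in> A \<and> R z)"
proof
  assume "\<exists>t\<in>A. pfst t = a \<and> pfst (psnd t) = b \<and> R (psnd (psnd t))"
  then obtain t where "t \<in> A" "pfst t = a" "pfst (psnd t) = b" "R (psnd (psnd t))" by blast
  moreover from this have "t = entry a b (psnd (psnd t))"
    by (metis prod.collapse prod_decode_inverse)
  ultimately show "\<exists>z. entry a b z \<in> A \<and> R z" by metis
next
  assume "\<exists>z. entry a b z \<in> A \<and> R z"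
  then obtain z where "entry a b z \<in> A" "R z" by blast
  then show "\<exists>t\<in>A. pfst t = a \<and> pfst (psnd t) = b \<and> R (psnd (psnd t))"
    by (intro bexI[of _ "entry a b z"]) simp_all
qed

lemma eval_step_encode:
  "eval_step w L (encode CZero) x y \<longleftrightarrow> y = 0"
  "eval_step w L (encode CSucc) x y \<longleftrightarrow> y = Suc x"
  "eval_step w L (encode CFst) x y \<longleftrightarrow> y = pfst x"
  "eval_step w L (encode CSnd) x y \<longleftrightarrow> y = psnd x"
  "eval_step w L (encode COracle) x y \<longleftrightarrow> x < length w \<and> y = w ! x"
  "eval_step w L (encode (CPair c d)) x y \<longleftrightarrow>
     entry (encode c) x (pfst y) \<in> set L \<and> entry (encode d) x (psnd y) \<in> set L"
  "eval_step w L (encode (CComp c d)) x y \<longleftrightarrow>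
     (\<exists>z. entry (encode d) x z \<in> set L \<and> entry (encode c) z y \<in> set L)"
  "eval_step w L (encode (CRec c d)) x y \<longleftrightarrow>
     psnd x = 0 \<and> entry (encode c) (pfst x) y \<in> set L \<or>
     0 < psnd x \<and> (\<exists>z. entry (encode (CRec c d)) (prod_encode (pfst x, psnd x - 1)) z \<in> set L \<and>
       entry (encode d) (prod_encode (pfst x, prod_encode (psnd x - 1, z))) y \<in> set L)"
  "eval_step w L (encode (CMin c)) x y \<longleftrightarrow>
     entry (encode c) (prod_encode (x, y)) 0 \<in> set L \<and>
     (\<forall>k<y. \<exists>z. entry (encode c) (prod_encode (x, k)) z \<in> set L \<and> 0 < z)"
proof -
  have mod: "Suc (4 * p) mod 4 = 1" "Suc (Suc (4 * p)) mod 4 = 2"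
    "Suc (Suc (Suc (4 * p))) mod 4 = 3" for p :: nat by presburger+
  have div: "Suc (4 * p) div 4 = p" "Suc (Suc (4 * p)) div 4 = p"
    "Suc (Suc (Suc (4 * p))) div 4 = p" for p :: nat by presburger+
  show "eval_step w L (encode CZero) x y \<longleftrightarrow> y = 0"
    "eval_step w L (encode CSucc) x y \<longleftrightarrow> y = Suc x"
    "eval_step w L (encode CFst) x y \<longleftrightarrow> y = pfst x"
    "eval_step w L (encode CSnd) x y \<longleftrightarrow> y = psnd x"
    "eval_step w L (encode COracle) x y \<longleftrightarrow> x < length w \<and> y = w ! x"
    unfolding eval_step_def by (auto simp: nth0_def)
  note simps = encode.simps eval_step_def mod div
  show "eval_step w L (encode (CPair c d)) x y \<longleftrightarrow>
     entry (encode c) x (pfst y) \<in> set L \<and> entry (encode d) x (psnd y) \<in> set L"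
    by (simp add: simps)
  show "eval_step w L (encode (CComp c d)) x y \<longleftrightarrow>
     (\<exists>z. entry (encode d) x z \<in> set L \<and> entry (encode c) z y \<in> set L)"
    by (simp add: simps Bex_entry[where R = "\<lambda>z. entry (encode c) z y \<in> set L"])
  show "eval_step w L (encode (CRec c d)) x y \<longleftrightarrow>
     psnd x = 0 \<and> entry (encode c) (pfst x) y \<in> set L \<or>
     0 < psnd x \<and> (\<exists>z. entry (encode (CRec c d)) (prod_encode (pfst x, psnd x - 1)) z \<in> set L \<and>
       entry (encode d) (prod_encode (pfst x, prod_encode (psnd x - 1, z))) y \<in> set L)"
    by (simp add: simps Bex_entry[where R = "\<lambda>z. entry (encode d) (prod_encode (pfst x, prod_encode (psnd x - Suc 0, z))) y \<in> set L"])
  show "eval_step w L (encode (CMin c)) x y \<longleftrightarrow>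
     entry (encode c) (prod_encode (x, y)) 0 \<in> set L \<and>
     (\<forall>k<y. \<exists>z. entry (encode c) (prod_encode (x, k)) z \<in> set L \<and> 0 < z)"
    by (simp add: simps Bex_entry[where R = "\<lambda>z. 0 < z"])
qed

section \<open>Soundness and completeness of derivations\<close>

definition holds :: "(nat \<Rightarrow> nat) \<Rightarrow> nat \<Rightarrow> bool" where
  "holds f t \<longleftrightarrow> ev f (decode (pfst t)) (pfst (psnd t)) = Some (psnd (psnd t))"

lemma holds_entry: "holds f (entry e x y) \<longleftrightarrow> ev f (decode e) x = Some y"
  by (simp add: holds_def)

text \<open>Finitely many oracle values certify a computation: \<open>w\<close> has to agree with
  \<open>f\<close> only where it is defined. For \<open>CMin\<close>, minimality follows from the
  positive values recorded at smaller arguments.\<close>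

lemma eval_step_sound:
  assumes L: "\<forall>t\<in>set L. holds f t" and w: "\<forall>i<length w. w ! i = f i"
    and st: "eval_step w L e x y"
  shows "ev f (decode e) x = Some y"
proof -
  define c where "c = decode e"
  have e: "e = encode c" by (simp add: c_def encode_decode)
  have L': "entry (encode d) x' y' \<in> set L \<Longrightarrow> ev f d x' = Some y'" for d x' y'
    using L by (auto simp: holds_entry decode_encode dest!: bspec)
  have "ev f c x = Some y"
  proof (cases c)
    case (CRec c1 c2)
    show ?thesis
    proof (cases "psnd x")
      case 0
      with st L' show ?thesis unfolding e CRec eval_step_encode by (auto simp: split_beta)
    next
      case (Suc n)
      then obtain z where "entry (encode (CRec c1 c2)) (prod_encode (pfst x, n)) z \<in> set L"
        "entry (encode c2) (prod_encode (pfst x, prod_encode (n, z))) y \<in> set L"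
        using st unfolding e CRec eval_step_encode by auto
      from this[THEN L'] show ?thesis unfolding CRec using Suc by (simp add: split_beta)
    qed
  next
    case (CMin d)
    from st have y: "ev f d (prod_encode (x, y)) = Some 0"
      and less: "\<forall>k<y. \<exists>z. ev f d (prod_encode (x, k)) = Some z \<and> 0 < z"
      unfolding e CMin eval_step_encode using L' by meson+
    have "(LEAST n. ev f d (prod_encode (x, n)) = Some 0) = y"
      using y less by (intro Least_equality) (auto simp: not_less[symmetric])
    with y less show ?thesis unfolding CMin by fastforce
  next
    case (CPair c1 c2)
    from st have "ev f c1 x = Some (pfst y)" "ev f c2 x = Some (psnd y)"
      unfolding e CPair eval_step_encode using L' by blast+
    then show ?thesis unfolding CPair by simp
  next
    case (CComp c1 c2)
    from st obtain z where "ev f c2 x = Some z" "ev f c1 z = Some y"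
      unfolding e CComp eval_step_encode using L' by blast
    then show ?thesis unfolding CComp by simp
  qed (use st w in \<open>unfold e, auto simp: eval_step_encode simp del: encode.simps\<close>)
  then show ?thesis by (simp add: c_def)
qed

definition derivation :: "nat list \<Rightarrow> nat list \<Rightarrow> bool" where
  "derivation w D \<longleftrightarrow> (\<forall>i<length D. eval_step w (drop (Suc i) D)
     (pfst (nth0 D i)) (pfst (psnd (nth0 D i))) (psnd (psnd (nth0 D i))))"

lemma derivation_Nil: "derivation w []"
  by (simp add: derivation_def)

lemma derivation_Cons:
  "derivation w (t # D) \<longleftrightarrow>
     eval_step w D (pfst t) (pfst (psnd t)) (psnd (psnd t)) \<and> derivation w D"
  unfolding derivation_def by (simp add: All_less_Suc2 nth0_def)

lemma derivation_sound:
  assumes "derivation w D" "\<forall>i<length w. w ! i = f i"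
  shows "\<forall>t\<in>set D. holds f t"
  using assms(1)
proof (induction D)
  case (Cons t D)
  then have "\<forall>t\<in>set D. holds f t" and "holds f t"
    using eval_step_sound[OF _ assms(2), of D] by (simp_all add: derivation_Cons holds_def)
  then show ?case by simp
qed simp

text \<open>\<open>eval_step\<close> uses \<open>L\<close> only positively: even the
  \<open>CMin\<close> clause asks for entries with positive values instead of the absence of zero
  entries. Hence derivations can be concatenated.\<close>

lemma eval_step_mono:
  assumes "eval_step w L e x y" "set L \<subseteq> set L'"
  shows "eval_step w L' e x y"
proof -
  define c where "c = decode e"
  have e: "e = encode c" by (simp add: c_def encode_decode)
  show ?thesis
  proof (cases c)
    case (CMin d)
    with assms show ?thesis unfolding e CMin eval_step_encode by (meson subsetD)
  qed (use assms in \<open>unfold e, auto simp: eval_step_encode simp del: encode.simps\<close>)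
qed

lemma derivation_append:
  "derivation w D \<Longrightarrow> derivation w E \<Longrightarrow> derivation w (D @ E)"
  by (induction D) (auto simp: derivation_Cons elim: eval_step_mono)

text \<open>The same \<open>D\<close> serves all strings that agree with \<open>f\<close> below
  \<open>n\<close>, whatever follows. So a derivation from a member of the class can be transferred
  to a string that departs from this member later.\<close>

definition derivable :: "(nat \<Rightarrow> nat) \<Rightarrow> nat \<Rightarrow> bool" where
  "derivable f t \<longleftrightarrow> (\<exists>n D. t \<in> set D \<and>
     (\<forall>w. n \<le> length w \<longrightarrow> (\<forall>i<n. w ! i = f i) \<longrightarrow> derivation w D))"

lemma derivable_list:
  assumes "\<forall>t\<in>set L. derivable f t"
  shows "\<exists>n D. set L \<subseteq> set D \<and> (\<forall>w. n \<le> length w \<longrightarrow> (\<forall>i<n. w ! i = f i) \<longrightarrow> derivation w D)"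
  using assms
proof (induction L)
  case Nil
  show ?case by (intro exI[of _ 0] exI[of _ "[]"]) (simp add: derivation_Nil)
next
  case (Cons t L)
  obtain n D where 1: "set L \<subseteq> set D"
    "\<And>w. n \<le> length w \<Longrightarrow> \<forall>i<n. w ! i = f i \<Longrightarrow> derivation w D"
    using Cons by auto
  obtain m E where 2: "t \<in> set E"
    "\<And>w. m \<le> length w \<Longrightarrow> \<forall>i<m. w ! i = f i \<Longrightarrow> derivation w E"
    using Cons.prems unfolding derivable_def by auto
  show ?case
    using 1 2 by (intro exI[of _ "max n m"] exI[of _ "D @ E"]) (auto intro: derivation_append)
qed

lemma derivable_step:
  assumes "\<forall>t\<in>set L. derivable f t"
    and "\<And>w. n \<le> length w \<Longrightarrow> \<forall>i<n. w ! i = f i \<Longrightarrow> eval_step w L e x y"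
  shows "derivable f (entry e x y)"
proof -
  obtain m D where "set L \<subseteq> set D"
    "\<And>w. m \<le> length w \<Longrightarrow> \<forall>i<m. w ! i = f i \<Longrightarrow> derivation w D"
    using derivable_list[OF assms(1)] by blast
  then show ?thesis unfolding derivable_def using assms(2)
    by (intro exI[of _ "max n m"] exI[of _ "entry e x y # D"])
       (auto simp: derivation_Cons intro!: eval_step_mono[of _ L _ _ _ D])
qed

lemma derivable_complete: "ev f c x = Some y \<Longrightarrow> derivable f (entry (encode c) x y)"
proof (induction c arbitrary: x y)
  case COracle
  \<comment> \<open>The only constructor that queries the oracle; \<open>Suc x\<close> values of
    \<open>f\<close> make position \<open>x\<close> known.\<close>
  then show ?case
    by (intro derivable_step[of "[]" f "Suc x"]) (unfold eval_step_encode, auto)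
next
  case (CPair c d)
  then obtain a b where "ev f c x = Some a" "ev f d x = Some b" "y = prod_encode (a, b)"
    by (auto simp: bind_eq_Some_conv)
  with CPair.IH show ?case
    by (intro derivable_step[of "[entry (encode c) x a, entry (encode d) x b]" f 0])
       (unfold eval_step_encode, auto)
next
  case (CComp c d)
  then obtain z where "ev f d x = Some z" "ev f c z = Some y"
    by (auto simp: bind_eq_Some_conv)
  with CComp.IH show ?case
    by (intro derivable_step[of "[entry (encode d) x z, entry (encode c) z y]" f 0])
       (unfold eval_step_encode, auto)
next
  case (CRec c d)
  obtain u n where x: "x = prod_encode (u, n)" by (metis prod_decode_inverse surj_pair)
  have "ev f (CRec c d) (prod_encode (u, n)) = Some y \<Longrightarrow>
    derivable f (entry (encode (CRec c d)) (prod_encode (u, n)) y)" for n y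
  proof (induction n arbitrary: y)
    case 0
    with CRec.IH(1)[of u y] show ?case
      by (intro derivable_step[of "[entry (encode c) u y]" f 0])
         (unfold eval_step_encode, auto)
  next
    case (Suc n)
    then obtain v where v: "ev f (CRec c d) (prod_encode (u, n)) = Some v"
      "ev f d (prod_encode (u, prod_encode (n, v))) = Some y"
      by (auto simp: bind_eq_Some_conv)
    show ?case
    proof (rule derivable_step)
      let ?L = "[entry (encode (CRec c d)) (prod_encode (u, n)) v,
        entry (encode d) (prod_encode (u, prod_encode (n, v))) y]"
      show "\<forall>t\<in>set ?L. derivable f t" using Suc.IH[OF v(1)] CRec.IH(2)[OF v(2)]
        by (simp del: encode.simps)
      show "eval_step w ?L (encode (CRec c d)) (prod_encode (u, Suc n)) y" for w
        unfolding eval_step_encode by (auto simp del: encode.simps)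
    qed
  qed
  with CRec.prems x show ?case by blast
next
  case (CMin c)
  let ?A = "\<lambda>n. ev f c (prod_encode (x, n)) = Some 0"
  from CMin.prems have ex: "\<exists>n. ?A n \<and> (\<forall>m<n. ev f c (prod_encode (x, m)) \<noteq> None)"
    and y: "y = (LEAST n. ?A n)" by (auto split: if_splits)
  then have A: "?A y" by (metis (mono_tags, lifting) LeastI)
  have "\<exists>v. ev f c (prod_encode (x, k)) = Some v \<and> 0 < v" if "k < y" for k
  proof -
    have "\<not> ?A k" using not_less_Least[of k ?A] that y by blast
    moreover have "ev f c (prod_encode (x, k)) \<noteq> None"
      using ex that unfolding y by (meson Least_le less_le_trans)
    ultimately show ?thesis by auto
  qed
  then obtain v where v: "\<And>k. k < y \<Longrightarrow> ev f c (prod_encode (x, k)) = Some (v k) \<and> 0 < v k"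
    by metis
  show ?case
  proof (rule derivable_step)
    let ?L = "entry (encode c) (prod_encode (x, y)) 0 #
      map (\<lambda>k. entry (encode c) (prod_encode (x, k)) (v k)) [0..<y]"
    show "\<forall>t\<in>set ?L. derivable f t" using CMin.IH A v by auto
    show "eval_step w ?L (encode (CMin c)) x y" for w
      unfolding eval_step_encode
    proof (intro conjI allI impI)
      show "\<exists>z. entry (encode c) (prod_encode (x, k)) z \<in> set ?L \<and> 0 < z" if "k < y" for k
        using v that by (intro exI[of _ "v k"]) auto
    qed simp
  qed
qed (auto intro!: derivable_step[of "[]" _ 0] simp: eval_step_encode simp del: encode.simps)

text \<open>The arguments are first packed into one number, since the rules track a single argument;
  substituting the actual functions afterwards avoids shifting them under every quantifier.\<close>

lemma comp_pred_eval_step: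
  assumes "comp_list W" "comp_list L" "comp_fun E" "comp_fun X" "comp_fun Y"
  shows "comp_pred (\<lambda>g x. eval_step (W g x) (L g x) (E g x) (X g x) (Y g x))"
proof -
  have "comp_pred (\<lambda>g z. eval_step (list_decode (pfst z)) (list_decode (pfst (psnd z)))
    (pfst (psnd (psnd z))) (pfst (psnd (psnd (psnd z)))) (psnd (psnd (psnd (psnd z)))))"
    unfolding eval_step_def by (intro comp_intros)
  from comp_pred_comp[OF this, of "\<lambda>g x. prod_encode (list_encode (W g x),
    prod_encode (list_encode (L g x), entry (E g x) (X g x) (Y g x)))"]
  show ?thesis using assms by (simp add: comp_intros)
qed

lemma comp_pred_derivation [comp_intros]:
  assumes "comp_list W" "comp_list D"
  shows "comp_pred (\<lambda>g x. derivation (W g x) (D g x))"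
  unfolding derivation_def
  by (intro comp_intros comp_pred_eval_step comp_list_pfst assms)


section \<open>Computable functions, trees and learners as functionals\<close>

text \<open>\<open>computable\<close> refers to the zero oracle; replacing queries by
  \<open>CZero\<close> keeps these values and makes them the same for every oracle.\<close>

primrec erase_oracle :: "code \<Rightarrow> code" where
  "erase_oracle CZero = CZero"
| "erase_oracle CSucc = CSucc"
| "erase_oracle CFst = CFst"
| "erase_oracle CSnd = CSnd"
| "erase_oracle COracle = CZero"
| "erase_oracle (CPair c d) = CPair (erase_oracle c) (erase_oracle d)"
| "erase_oracle (CComp c d) = CComp (erase_oracle c) (erase_oracle d)"
| "erase_oracle (CRec c d) = CRec (erase_oracle c) (erase_oracle d)"
| "erase_oracle (CMin c) = CMin (erase_oracle c)"

lemma ev_erase_oracle: "ev g (erase_oracle c) = ev (\<lambda>_. 0) c"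
  by (induction c) (simp_all only: erase_oracle.simps ev.simps)

lemma comp_fun_computable:
  assumes "computable f" "comp_fun A" shows "comp_fun (\<lambda>g x. f (A g x))"
proof -
  obtain c where "\<forall>n. ev (\<lambda>_. 0) c n = Some (f n)" using assms(1) unfolding computable_def by blast
  then have "comp_fun (\<lambda>g x. f x)"
    unfolding comp_fun_def by (intro exI[of _ "erase_oracle c"]) (simp add: ev_erase_oracle)
  then show ?thesis using comp_fun_comp assms(2) by fast
qed

lemma computable_comp_fun: "comp_fun (\<lambda>_. f) \<Longrightarrow> computable f"
  unfolding comp_fun_def computable_def by blast

lemma comp_fun_list_fun:
  assumes "computable_list_fun \<psi>" "comp_list A" shows "comp_fun (\<lambda>g x. \<psi> (A g x))"
  using comp_fun_computable[OF assms(1)[unfolded computable_list_fun_def]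
    comp_list_encode[OF assms(2)]] by simp

lemma comp_pred_tree:
  assumes "computable_tree T" "comp_list A" shows "comp_pred (\<lambda>g x. A g x \<in> T)"
  using comp_fun_list_fun[of "\<lambda>\<sigma>. if \<sigma> \<in> T then 1 else 0" A] assms
  by (simp add: computable_tree_def comp_pred_def)

text \<open>This makes being a leaf decidable: in a binary tree every proper extension passes
  through one of the two immediate successors.\<close>

lemma leaves_iff:
  assumes "binary_tree T"
  shows "\<sigma> \<in> leaves T \<longleftrightarrow> \<sigma> \<in> T \<and> \<sigma> @ [0] \<notin> T \<and> \<sigma> @ [1] \<notin> T"
proof
  assume "\<sigma> \<in> leaves T"
  then show "\<sigma> \<in> T \<and> \<sigma> @ [0] \<notin> T \<and> \<sigma> @ [1] \<notin> T"
    by (auto simp: leaves_def strict_prefix_def)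
next
  assume \<sigma>: "\<sigma> \<in> T \<and> \<sigma> @ [0] \<notin> T \<and> \<sigma> @ [1] \<notin> T"
  have "\<not> strict_prefix \<sigma> \<tau>" if "\<tau> \<in> T" for \<tau>
  proof
    assume "strict_prefix \<sigma> \<tau>"
    then obtain b \<tau>' where \<tau>: "\<tau> = \<sigma> @ b # \<tau>'" using strict_prefixE' by blast
    then have "b \<in> {0, 1}" "\<sigma> @ [b] \<in> T"
      using that assms unfolding binary_tree_def by (auto simp: prefix_def dest!: bspec)
    with \<sigma> show False by auto
  qed
  with \<sigma> show "\<sigma> \<in> leaves T" by (simp add: leaves_def)
qed

section \<open>Restrictions of functions and limits of strings\<close>

lemma length_restr [simp]: "length (restr f n) = n"
  by (simp add: restr_def)

lemma nth_restr [simp]: "i < n \<Longrightarrow> restr f n ! i = f i"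
  by (simp add: restr_def)

lemma restr_0 [simp]: "restr f 0 = []"
  by (simp add: restr_def)

lemma restr_Suc: "restr f (Suc n) = restr f n @ [f n]"
  by (simp add: restr_def)

lemma restr_eqI: "length u = n \<Longrightarrow> (\<And>i. i < n \<Longrightarrow> u ! i = f i) \<Longrightarrow> restr f n = u"
  by (rule nth_equalityI) auto

lemma restr_mono: "m \<le> n \<Longrightarrow> prefix (restr f m) (restr f n)"
  unfolding prefix_def restr_def by (metis le0 le_add_diff_inverse map_append upt_add_eq_append)

lemma prefix_chain_limit:
  fixes u :: "nat \<Rightarrow> nat list"
  assumes "\<And>n. prefix (u n) (u (Suc n))" "\<And>n. n \<le> length (u n)"
  shows "\<exists>x. \<forall>n. restr x (length (u n)) = u n"
proof -
  have mono: "prefix (u m) (u n)" if "m \<le> n" for m n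
    using that by (induction rule: dec_induct) (auto intro: assms prefix_order.trans)
  have nth: "u m ! i = u n ! i" if "i < length (u m)" "i < length (u n)" for m n i
    using mono[of m n] mono[of n m] that by (cases "m \<le> n") (auto simp: prefix_def nth_append)
  \<comment> \<open>Value \<open>i\<close> is taken from \<open>u (Suc i)\<close>, which is long
    enough; all strings of the chain that reach position \<open>i\<close> agree there.\<close>
  have "restr (\<lambda>i. u (Suc i) ! i) (length (u n)) = u n" for n
    using assms(2) by (intro restr_eqI refl nth) (simp_all add: Suc_le_lessD)
  then show ?thesis by blast
qed

text \<open>Otherwise the leftmost path above the string would be computable.\<close>

lemma special_leaf_above:
  assumes T: "computable_tree T" and sp: "special (paths T)" and \<sigma>: "\<sigma> \<in> T"
  shows "\<exists>\<rho>\<in>leaves T. prefix \<sigma> \<rho>"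
proof (rule ccontr)
  assume no: "\<not> (\<exists>\<rho>\<in>leaves T. prefix \<sigma> \<rho>)"
  have bin: "binary_tree T" using T by (simp add: computable_tree_def)
  define next_bit where "next_bit \<tau> = (if \<tau> @ [0] \<in> T then 0 else 1 :: nat)" for \<tau>
  define u where "u n = rec_nat \<sigma> (\<lambda>_ \<tau>. \<tau> @ [next_bit \<tau>]) n" for n
  have u: "u 0 = \<sigma>" "u (Suc n) = u n @ [next_bit (u n)]" for n by (simp_all add: u_def)
  have uT: "u n \<in> T \<and> prefix \<sigma> (u n)" for n
  proof (induction n)
    case (Suc n)
    then have "u n \<notin> leaves T" using no by blast
    with Suc show ?case unfolding u next_bit_def by (auto simp: leaves_iff[OF bin])
  qed (simp add: u \<sigma>)
  have len: "length (u n) = length \<sigma> + n" for n by (induction n) (simp_all add: u)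
  obtain x where x: "\<And>n. restr x (length (u n)) = u n"
    using prefix_chain_limit[of u] by (auto simp: u len)
  have "x \<in> paths T"
  proof -
    have "restr x n \<in> T" for n
      using uT[of n] restr_mono[of n "length (u n)" x] bin x[of n] len[of n]
      unfolding binary_tree_def by auto
    then show ?thesis by (simp add: paths_def)
  qed
  moreover have "computable x"
  proof -
    have enc: "rec_nat (list_encode \<sigma>) (\<lambda>_ v. list_encode (list_decode v @ [next_bit (list_decode v)])) n
      = list_encode (u n)" for n by (induction n) (simp_all add: u)
    \<comment> \<open>\<open>u (Suc n)\<close> is longer than \<open>n\<close> even when \<sigma> is
      empty, so the default of \<open>nth0\<close> is never read.\<close>
    have "comp_fun (\<lambda>g n. nth0 (list_decode (rec_nat (list_encode \<sigma>)
        (\<lambda>_ v. list_encode (list_decode v @ [next_bit (list_decode v)])) (Suc n))) n)"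
      unfolding next_bit_def by (intro comp_intros comp_pred_tree[OF T])
    moreover have "nth0 (u (Suc n)) n = x n" for n
    proof -
      have "n < length (u (Suc n))" by (simp add: len)
      then show ?thesis using x[of "Suc n"] nth_restr[of n "length (u (Suc n))" x] by (simp add: nth0_def)
    qed
    ultimately show ?thesis by (intro computable_comp_fun) (simp only: enc list_encode_inverse)
  qed
  ultimately show False using sp by (auto simp: special_def)
qed

section \<open>Strings in the hyperconcatenation\<close>

definition conc :: "nat list \<Rightarrow> (nat \<Rightarrow> nat) \<Rightarrow> nat \<Rightarrow> nat" where
  "conc u f = (\<lambda>i. if i < length u then u ! i else f (i - length u))"

lemma restr_conc: "restr (conc u f) (length u + m) = u @ restr f m"
  by (rule restr_eqI) (auto simp: conc_def nth_append)

lemma interleave_snoc: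
  "length S = length \<tau> \<Longrightarrow> interleave (S @ [\<rho>]) (\<tau> @ [a]) = interleave S \<tau> @ \<rho> @ [a]"
  by (simp add: interleave_def)

text \<open>The string \<open>restr f m\<close> is in \<open>TP\<close> and serves as the last,
  unfinished block.\<close>

lemma conc_in_hyperconcat:
  assumes "f \<in> paths TP" "set S \<subseteq> leaves TP" "\<tau> \<in> TQ" "length S = length \<tau>"
  shows "conc (interleave S \<tau>) f \<in> hyperconcat TQ TP"
proof -
  have "restr (conc (interleave S \<tau>) f) m \<in> hyperconcat_tree TQ TP" for m
  proof -
    have "prefix (restr (conc (interleave S \<tau>) f) m) (interleave S \<tau> @ restr f m)"
      using restr_mono[of m "length (interleave S \<tau>) + m" "conc (interleave S \<tau>) f"] by (simp add: restr_conc)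
    then show ?thesis using assms unfolding hyperconcat_tree_def paths_def by blast
  qed
  then show ?thesis by (simp add: hyperconcat_def paths_def)
qed

text \<open>The segment of \<open>join x g\<close> that is known once \<open>u\<close> is known of
  \<open>x\<close>. Only \<open>length u\<close> values of \<open>g\<close> enter, and the default
  of \<open>nth0\<close> is never read.\<close>

definition joinl :: "nat list \<Rightarrow> (nat \<Rightarrow> nat) \<Rightarrow> nat list" where
  "joinl u g = restr (join (nth0 u) g) (2 * length u)"

lemma length_joinl [simp]: "length (joinl u g) = 2 * length u"
  by (simp add: joinl_def)

lemma joinl_restr: "joinl (restr f n) g = restr (join f g) (2 * n)"
  unfolding joinl_def by (rule restr_eqI) (auto simp: join_def nth0_def)

lemma joinl_cong: "(\<And>i. i < length u \<Longrightarrow> g i = h i) \<Longrightarrow> joinl u g = joinl u h"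
  unfolding joinl_def by (rule restr_eqI) (auto simp: join_def)

lemma comp_list_joinl:
  assumes "comp_list A" "comp_fun (\<lambda>g z. G g (pfst z) (psnd z))"
  shows "comp_list (\<lambda>g x. joinl (A g x) (G g x))"
proof -
  have G: "comp_fun (\<lambda>g z. G g (B g z) (C g z))" if "comp_fun B" "comp_fun C" for B C
    using comp_fun_comp[OF assms(2) comp_fun_pair[OF that]] by simp
  show ?thesis unfolding joinl_def restr_def join_def
    by (intro comp_intros comp_list_pfst assms G)
qed

text \<open>A learner that is constant on these strings above \<open>u\<close> has one guess for all
  first components \<open>u h\<close> and \<open>u \<rho> a h\<close>.\<close>

definition extensions :: "nat list set \<Rightarrow> nat \<Rightarrow> nat list set" where
  "extensions T a = T \<union> {\<rho> @ a # \<sigma> | \<rho> \<sigma>. \<rho> \<in> leaves T \<and> \<sigma> \<in> T}"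

text \<open>
  Mind changes above every position along a path \<open>q\<close> of \<open>TQ\<close> could be chained to a member of the
  hyperconcatenation on which the learner does not converge.
\<close>

lemma stable_position_exists:
  fixes \<psi> :: "nat list \<Rightarrow> nat"
  assumes TP: "computable_tree TP" "special (paths TP)" and q: "q \<in> paths TQ"
    and conv: "\<And>x. x \<in> hyperconcat TQ TP \<Longrightarrow> convergent (\<lambda>n. \<psi> (restr (join x g) n))"
  shows "\<exists>S \<tau> a. set S \<subseteq> leaves TP \<and> length S = length \<tau> \<and> \<tau> @ [a] \<in> TQ \<and>
    (\<forall>\<eta>\<in>extensions TP a.
      \<psi> (joinl (interleave S \<tau> @ \<eta>) g) = \<psi> (joinl (interleave S \<tau>) g))"
proof (rule ccontr)
  assume no: "\<not> ?thesis"
  define pos where "pos S = interleave S (restr q (length S))" for S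
  have pos_snoc: "pos (S @ [\<rho>]) = pos S @ \<rho> @ [q (length S)]" for S \<rho>
    by (simp add: pos_def restr_Suc interleave_snoc)
  have TQ: "restr q n \<in> TQ" for n using q by (simp add: paths_def)
  \<comment> \<open>Every position along \<open>q\<close> has a longer one beyond a mind change: one
    further leaf suffices if \<eta> is in \<open>TP\<close>, and two if \<eta> already passes a
    leaf.\<close>
  have ext: "\<exists>S'. set S' \<subseteq> leaves TP \<and> prefix (pos S) (pos S') \<and> length S < length S' \<and>
      (\<exists>\<eta>. prefix (pos S @ \<eta>) (pos S') \<and> \<psi> (joinl (pos S @ \<eta>) g) \<noteq> \<psi> (joinl (pos S) g))"
    if S: "set S \<subseteq> leaves TP" for S
  proof -
    have "restr q (length S) @ [q (length S)] \<in> TQ" using TQ[of "Suc (length S)"] by (simp add: restr_Suc)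
    then obtain \<eta> where \<eta>: "\<eta> \<in> extensions TP (q (length S))"
      and ne: "\<psi> (joinl (pos S @ \<eta>) g) \<noteq> \<psi> (joinl (pos S) g)"
      using no S unfolding pos_def by (metis length_restr)
    from \<eta> consider "\<eta> \<in> TP" | \<rho> \<sigma> where "\<rho> \<in> leaves TP" "\<sigma> \<in> TP" "\<eta> = \<rho> @ q (length S) # \<sigma>"
      unfolding extensions_def by blast
    then show ?thesis
    proof cases
      case 1
      then obtain \<rho> where "\<rho> \<in> leaves TP" "prefix \<eta> \<rho>" using special_leaf_above[OF TP] by blast
      then show ?thesis using S ne
        by (intro exI[of _ "S @ [\<rho>]"] conjI exI[of _ \<eta>]) (auto simp: pos_snoc prefix_def)
    next
      case 2
      then obtain \<rho>' where "\<rho>' \<in> leaves TP" "prefix \<sigma> \<rho>'" using special_leaf_above[OF TP] by blast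
      then show ?thesis using S ne 2
        by (intro exI[of _ "(S @ [\<rho>]) @ [\<rho>']"] conjI exI[of _ \<eta>]) (auto simp only: pos_snoc, auto simp: prefix_def)
    qed
  qed
  then obtain nxt where nxt: "\<And>S. set S \<subseteq> leaves TP \<Longrightarrow> set (nxt S) \<subseteq> leaves TP \<and>
    prefix (pos S) (pos (nxt S)) \<and> length S < length (nxt S) \<and>
    (\<exists>\<eta>. prefix (pos S @ \<eta>) (pos (nxt S)) \<and> \<psi> (joinl (pos S @ \<eta>) g) \<noteq> \<psi> (joinl (pos S) g))"
    by metis
  define s where "s n = (nxt ^^ n) []" for n
  have s: "set (s n) \<subseteq> leaves TP \<and> n \<le> length (s n)" for n
  proof (induction n)
    case (Suc n)
    then show ?case using nxt[of "s n"] by (auto simp: s_def)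
  qed (simp add: s_def)
  have step: "prefix (pos (s n)) (pos (s (Suc n)))"
    "\<exists>\<eta>. prefix (pos (s n) @ \<eta>) (pos (s (Suc n))) \<and>
       \<psi> (joinl (pos (s n) @ \<eta>) g) \<noteq> \<psi> (joinl (pos (s n)) g)" for n
    using nxt[of "s n"] s[of n] by (simp_all add: s_def)
  \<comment> \<open>Each block ends in a bit of \<open>q\<close>, so even empty leaves make the
    strings grow.\<close>
  have len_pos: "length S \<le> length (pos S)" for S
    by (induction S rule: rev_induct) (simp_all add: pos_snoc)
  have "n \<le> length (pos (s n))" for n using s[of n] len_pos[of "s n"] by linarith
  then obtain x where x: "\<And>n. restr x (length (pos (s n))) = pos (s n)"
    and len: "\<And>n. n \<le> length (pos (s n))"
    using prefix_chain_limit[of "\<lambda>n. pos (s n)", OF step(1)] by blast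
  have xp: "restr x (length u) = u" if "prefix u (pos (s n))" for u n
    using that restr_mono[of "length u" "length (pos (s n))" x] x[of n]
    by (metis prefix_length_le prefix_length_prefix length_restr prefix_order.antisym order_refl)
  have "[] \<in> TP" using TP unfolding special_def paths_def by (metis (no_types, lifting) ex_in_conv mem_Collect_eq restr_0)
  then have "restr x m \<in> hyperconcat_tree TQ TP" for m
    unfolding hyperconcat_tree_def mem_Collect_eq
    using restr_mono[OF len[of m], of x] s[of m] TQ[of "length (s m)"] x[of m]
    by (intro bexI[of _ "restr q (length (s m))"] exI[of _ "s m"] bexI[of _ "[]"])
       (simp_all add: pos_def)
  then have "x \<in> hyperconcat TQ TP" by (simp add: hyperconcat_def paths_def)
  from conv[OF this] obtain l where "(\<lambda>n. \<psi> (restr (join x g) n)) \<longlonglongrightarrow> l"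
    unfolding convergent_def by blast
  then obtain N where N: "\<And>n. N \<le> n \<Longrightarrow> \<psi> (restr (join x g) n) = l"
    unfolding tendsto_discrete eventually_sequentially by blast
  obtain \<eta> where \<eta>: "prefix (pos (s N) @ \<eta>) (pos (s (Suc N)))"
    "\<psi> (joinl (pos (s N) @ \<eta>) g) \<noteq> \<psi> (joinl (pos (s N)) g)" using step(2) by blast
  \<comment> \<open>Both sides of the mind change at stage \<open>N\<close> come from initial
    segments of \<open>x\<close> of length at least \<open>N\<close>, where the learner has settled
    on \<open>l\<close>.\<close>
  have "\<psi> (joinl u g) = l" if "prefix u (pos (s n))" "N \<le> length u" for u n
    using joinl_restr[of x "length u" g] xp[OF that(1)] N[of "2 * length u"] that(2) by simp
  from this[OF \<eta>(1)] this[of "pos (s N)" N] \<eta>(2) len[of N] show False by simp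
qed


section \<open>Nested iteration of a functional on a special class\<close>

text \<open>
  A certificate codes a leaf \<open>\<rho>\<close> and a list of pairs \<open>(Z\<^sub>j, D\<^sub>j)\<close>, where \<open>D\<^sub>j\<close> derives the string
  \<open>Z\<^sub>j\<close> from the \<open>j\<close>-th leaf of the current list of certificates and the string \<open>Z\<^bsub>j+1\<^esub>\<close>.
\<close>

abbreviation cert_leaf :: "nat \<Rightarrow> nat list" where
  "cert_leaf t \<equiv> list_decode (pfst t)"

abbreviation cert_out :: "nat \<Rightarrow> nat \<Rightarrow> nat list" where
  "cert_out t j \<equiv> list_decode (pfst (nth0 (list_decode (psnd t)) j))"

abbreviation cert_deriv :: "nat \<Rightarrow> nat \<Rightarrow> nat list" where
  "cert_deriv t j \<equiv> list_decode (psnd (nth0 (list_decode (psnd t)) j))"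

text \<open>The last string is empty, so the outputs do not depend on the innermost argument; the
  first has more than \<open>length L\<close> values, enough to fix value number
  \<open>length L\<close> of the limit. From \<open>L\<close> only the leaves are used: all
  intermediate strings are computed anew.\<close>

definition cert ::
    "nat list set \<Rightarrow> (nat \<Rightarrow> nat) \<Rightarrow> nat list \<Rightarrow> nat \<Rightarrow> nat \<Rightarrow> nat list \<Rightarrow> nat \<Rightarrow> bool" where
  "cert T g u a e L t \<longleftrightarrow>
     cert_leaf t \<in> leaves T \<and> length L < length (cert_out t 0) \<and>
     length (cert_out t (Suc (length L))) = 0 \<and>
     (\<forall>j<Suc (length L).
        derivation (joinl (u @ cert_leaf (nth0 (L @ [t]) j) @ a # cert_out t (Suc j)) g)
          (cert_deriv t j) \<and>
        (\<forall>k<length (cert_out t j). entry e k (nth0 (cert_out t j) k) \<in> set (cert_deriv t j)))"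

text \<open>Bounded quantifiers express that \<open>L\<close> lists successive least certificates,
  so a single unbounded search for \<open>L\<close> suffices.\<close>

definition cert_search ::
    "nat list set \<Rightarrow> (nat \<Rightarrow> nat) \<Rightarrow> nat list \<Rightarrow> nat \<Rightarrow> nat \<Rightarrow> nat \<Rightarrow> nat list \<Rightarrow> bool" where
  "cert_search T g u a e n L \<longleftrightarrow> length L = Suc n \<and>
     (\<forall>k<Suc n. cert T g u a e (take k L) (nth0 L k) \<and>
        (\<forall>t<nth0 L k. \<not> cert T g u a e (take k L) t))"

section \<open>Decidability of certificates\<close>

lemma comp_pred_leaves:
  assumes "computable_tree T" "comp_list A" shows "comp_pred (\<lambda>g x. A g x \<in> leaves T)"
proof -
  have "binary_tree T" using assms(1) by (simp add: computable_tree_def)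
  then show ?thesis unfolding leaves_iff[OF \<open>binary_tree T\<close>]
    by (intro comp_intros comp_pred_tree assms)
qed

lemma comp_pred_cert:
  assumes T: "computable_tree T" and "comp_list U" "comp_fun A" "comp_fun E" "comp_list L" "comp_fun C"
  shows "comp_pred (\<lambda>g x. cert T g (U g x) (A g x) (E g x) (L g x) (C g x))"
proof -
  have "comp_pred (\<lambda>g z. cert T g (list_decode (pfst z)) (pfst (psnd z)) (pfst (psnd (psnd z)))
    (list_decode (pfst (psnd (psnd (psnd z))))) (psnd (psnd (psnd (psnd z)))))"
    unfolding cert_def by (intro comp_intros comp_pred_leaves[OF T] comp_list_joinl)
  from comp_pred_comp[OF this, of "\<lambda>g x. prod_encode (list_encode (U g x), prod_encode (A g x,
    prod_encode (E g x, prod_encode (list_encode (L g x), C g x))))"]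
  show ?thesis using assms by (simp add: comp_intros)
qed

lemma comp_pred_cert_search:
  assumes T: "computable_tree T" and "comp_list U" "comp_fun A" "comp_fun E" "comp_fun N" "comp_list L"
  shows "comp_pred (\<lambda>g x. cert_search T g (U g x) (A g x) (E g x) (N g x) (L g x))"
proof -
  have "comp_pred (\<lambda>g z. cert_search T g (list_decode (pfst z)) (pfst (psnd z)) (pfst (psnd (psnd z)))
    (pfst (psnd (psnd (psnd z)))) (list_decode (psnd (psnd (psnd (psnd z))))))"
    unfolding cert_search_def by (intro comp_intros comp_pred_cert[OF T])
  from comp_pred_comp[OF this, of "\<lambda>g x. prod_encode (list_encode (U g x), prod_encode (A g x,
    prod_encode (E g x, prod_encode (N g x, list_encode (L g x)))))"]
  show ?thesis using assms by (simp add: comp_intros)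
qed

lemma joinl_conc:
  assumes "\<forall>k<length Z. Z ! k = h k" and "i < 2 * length (u @ Z)"
  shows "joinl (u @ Z) g ! i = join (conc u h) g i"
proof -
  have "u @ Z = restr (conc u h) (length u + length Z)"
    unfolding restr_conc using assms(1) by (simp add: restr_eqI)
  then show ?thesis using assms(2) by (simp add: joinl_restr)
qed

lemma Phi_eval: "Phi e x = Some y \<Longrightarrow> ev x (decode e) n = Some (y n)"
  by (auto simp: Phi_def split: if_splits)

lemma Phi_derivation:
  assumes "Phi e x = Some y"
  shows "\<exists>m D. (\<forall>k<n. entry e k (y k) \<in> set D) \<and>
    (\<forall>w. m \<le> length w \<longrightarrow> (\<forall>i<m. w ! i = x i) \<longrightarrow> derivation w D)"
proof -
  have "derivable x (entry e k (y k))" for k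
    using derivable_complete[of x "decode e"] Phi_eval[OF assms] by (simp add: encode_decode)
  then obtain m D where "set (map (\<lambda>k. entry e k (y k)) [0..<n]) \<subseteq> set D"
    "\<forall>w. m \<le> length w \<longrightarrow> (\<forall>i<m. w ! i = x i) \<longrightarrow> derivation w D"
    using derivable_list[of "map (\<lambda>k. entry e k (y k)) [0..<n]" x] by auto
  then show ?thesis by (intro exI[of _ m] exI[of _ D]) auto
qed

text \<open>\<open>step\<close> gives the maps of the class into itself, and \<open>base\<close> a
  computation that does not wait for a leaf. Both use the same index \<open>e\<close>, which
  stability of the position provides.\<close>

locale nested_functional =
  fixes T :: "nat list set" and g :: "nat \<Rightarrow> nat" and u :: "nat list" and a e :: nat
  assumes tree: "computable_tree T" and special: "special (paths T)"
    and base: "h \<in> paths T \<Longrightarrow> \<exists>y\<in>paths T. Phi e (join (conc u h) g) = Some y"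
    and step: "\<rho> \<in> leaves T \<Longrightarrow> h \<in> paths T \<Longrightarrow>
      \<exists>y\<in>paths T. Phi e (join (conc (u @ \<rho> @ [a]) h) g) = Some y"
begin

definition apply_leaf :: "nat list \<Rightarrow> (nat \<Rightarrow> nat) \<Rightarrow> nat \<Rightarrow> nat" where
  "apply_leaf \<rho> h = the (Phi e (join (conc (u @ \<rho> @ [a]) h) g))"

lemma apply_leaf:
  assumes "\<rho> \<in> leaves T" "h \<in> paths T"
  shows "apply_leaf \<rho> h \<in> paths T"
    and "Phi e (join (conc (u @ \<rho> @ [a]) h) g) = Some (apply_leaf \<rho> h)"
  using step[OF assms] by (auto simp: apply_leaf_def)

text \<open>With \<open>foldr\<close>, a certificate appended to the list acts innermost, so it
  changes only the argument of the earlier maps.\<close>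

definition nest :: "nat list \<Rightarrow> (nat \<Rightarrow> nat) \<Rightarrow> nat \<Rightarrow> nat" where
  "nest L = foldr (\<lambda>t. apply_leaf (cert_leaf t)) L"

lemma nest_in_paths:
  "\<forall>t\<in>set L. cert_leaf t \<in> leaves T \<Longrightarrow> h \<in> paths T \<Longrightarrow> nest L h \<in> paths T"
  by (induction L) (simp_all add: nest_def apply_leaf)

text \<open>Downward induction from the empty string at the innermost level: once a string is an
  initial segment of the true argument, soundness of derivations gives the next outer string. As
  \<open>h\<close> is an arbitrary member of the class, the effect of later certificates can be
  substituted for it.\<close>

lemma cert_sound:
  assumes L: "\<forall>t\<in>set L. cert_leaf t \<in> leaves T" and c: "cert T g u a e L t" and h: "h \<in> paths T"
    and "j \<le> Suc (length L)"
  shows "\<forall>k<length (cert_out t j). cert_out t j ! k = nest (drop j (L @ [t])) h k"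
  using assms(4)
proof (induction j rule: inc_induct)
  case base
  then show ?case using c by (simp add: cert_def)
next
  case (step j)
  let ?L = "L @ [t]"
  let ?h = "nest (drop (Suc j) ?L) h"
  let ?\<rho> = "cert_leaf (?L ! j)"
  have leaf: "\<forall>t'\<in>set ?L. cert_leaf t' \<in> leaves T" using L c by (simp add: cert_def)
  have j: "j < length ?L" using step by simp
  have \<rho>: "?\<rho> \<in> leaves T" using leaf nth_mem[OF j] by blast
  have h': "?h \<in> paths T" using nest_in_paths[OF _ h] leaf by (meson in_set_dropD)
  have nest: "nest (drop j ?L) h = apply_leaf ?\<rho> ?h"
    using Cons_nth_drop_Suc[OF j, symmetric] by (simp add: nest_def)
  let ?w = "joinl (u @ ?\<rho> @ a # cert_out t (Suc j)) g"
  have d: "derivation ?w (cert_deriv t j)"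
    and k: "\<And>k. k < length (cert_out t j) \<Longrightarrow> entry e k (cert_out t j ! k) \<in> set (cert_deriv t j)"
    using c step j unfolding cert_def by (auto simp: nth0_def less_Suc_eq_le)
  have "\<forall>i<length ?w. ?w ! i = join (conc (u @ ?\<rho> @ [a]) ?h) g i"
    using joinl_conc[OF step.IH, of _ "u @ ?\<rho> @ [a]"] by simp
  from derivation_sound[OF d this] have "holds (join (conc (u @ ?\<rho> @ [a]) ?h) g)
      (entry e k (cert_out t j ! k))" if "k < length (cert_out t j)" for k
    using k[OF that] by blast
  then show ?case unfolding nest holds_entry using Phi_eval[OF apply_leaf(2)[OF \<rho> h']] by simp
qed

text \<open>The finite use of each map is passed inwards: \<open>n\<close> values outside need some
  \<open>m\<close> values of the next argument, whence the induction over \<open>L\<close> with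
  \<open>n\<close> arbitrary.\<close>

lemma nest_approximation:
  assumes "\<forall>t\<in>set L. cert_leaf t \<in> leaves T" "h \<in> paths T"
  shows "\<exists>Z D. Z 0 = restr (nest L h) n \<and> (\<exists>m. Z (length L) = restr h m) \<and>
    (\<forall>j<length L. derivation (joinl (u @ cert_leaf (L ! j) @ a # Z (Suc j)) g) (D j) \<and>
      (\<forall>k<length (Z j). entry e k (Z j ! k) \<in> set (D j)))"
  using assms(1)
proof (induction L arbitrary: n)
  case Nil
  show ?case by (intro exI[of _ "\<lambda>_. restr h n"]) (auto simp: nest_def)
next
  case (Cons t L)
  let ?h = "nest L h" and ?\<rho> = "cert_leaf t"
  have \<rho>: "?\<rho> \<in> leaves T" and h': "?h \<in> paths T" using Cons.prems nest_in_paths[OF _ assms(2)] by auto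
  obtain m E where E: "\<forall>k<n. entry e k (apply_leaf ?\<rho> ?h k) \<in> set E"
    and dE: "\<And>w. m \<le> length w \<Longrightarrow> \<forall>i<m. w ! i = join (conc (u @ ?\<rho> @ [a]) ?h) g i \<Longrightarrow> derivation w E"
    using Phi_derivation[OF apply_leaf(2)[OF \<rho> h']] by blast
  obtain Z D where Z: "Z 0 = restr ?h m" "\<exists>m. Z (length L) = restr h m"
    "\<And>j. j < length L \<Longrightarrow> derivation (joinl (u @ cert_leaf (L ! j) @ a # Z (Suc j)) g) (D j) \<and>
      (\<forall>k<length (Z j). entry e k (Z j ! k) \<in> set (D j))"
    using Cons.IH[of m] Cons.prems by auto
  have d: "derivation (joinl (u @ ?\<rho> @ a # Z 0) g) E"
    using joinl_conc[of "restr ?h m" ?h _ "u @ ?\<rho> @ [a]" g] by (intro dE) (simp_all add: Z)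
  show ?case
  proof (intro exI conjI allI impI)
    let ?Z = "case_nat (restr (apply_leaf ?\<rho> ?h) n) Z" and ?D = "case_nat E D"
    show "?Z 0 = restr (nest (t # L) h) n" by (simp add: nest_def)
    show "?Z (length (t # L)) = restr h (SOME m. Z (length L) = restr h m)"
      using someI_ex[OF Z(2)] by simp
    fix j assume "j < length (t # L)"
    then show "derivation (joinl (u @ cert_leaf ((t # L) ! j) @ a # ?Z (Suc j)) g) (?D j)"
      using Z(3) d by (cases j) auto
    fix k assume "k < length (?Z j)"
    then show "entry e k (?Z j ! k) \<in> set (?D j)"
      using Z(3) E \<open>j < length (t # L)\<close> by (cases j) auto
  qed
qed

text \<open>
  The new leaf extends a long initial segment of a member \<open>h\<close> of the class, on which the functional
  is total by \<open>base\<close>.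
\<close>

lemma cert_exists:
  assumes L: "\<forall>t\<in>set L. cert_leaf t \<in> leaves T"
  shows "\<exists>t. cert T g u a e L t"
proof -
  obtain h where h: "h \<in> paths T" using special by (auto simp: special_def)
  obtain f where f: "f \<in> paths T" "Phi e (join (conc u h) g) = Some f" using base[OF h] by blast
  obtain Z D m where Z: "Z 0 = restr (nest L f) (Suc (length L))" "Z (length L) = restr f m"
    "\<And>j. j < length L \<Longrightarrow> derivation (joinl (u @ cert_leaf (L ! j) @ a # Z (Suc j)) g) (D j) \<and>
      (\<forall>k<length (Z j). entry e k (Z j ! k) \<in> set (D j))"
    using nest_approximation[OF L f(1), of "Suc (length L)"] by blast
  obtain n E where E: "\<forall>k<m. entry e k (f k) \<in> set E"
    and dE: "\<And>w. n \<le> length w \<Longrightarrow> \<forall>i<n. w ! i = join (conc u h) g i \<Longrightarrow> derivation w E"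
    using Phi_derivation[OF f(2)] by blast
  have "restr h n \<in> T" using h by (simp add: paths_def)
  then obtain \<rho> where \<rho>: "\<rho> \<in> leaves T" "prefix (restr h n) \<rho>"
    using special_leaf_above[OF tree special] by blast
  then obtain v where v: "\<rho> = restr h n @ v" by (auto simp: prefix_def)
  \<comment> \<open>The derivation \<open>E\<close> of the needed values of \<open>f\<close> depends
    on the oracle below \<open>n\<close> only, where the leaf agrees with \<open>h\<close>; hence
    nothing has to follow the bit \<open>a\<close>.\<close>
  have d: "derivation (joinl (u @ \<rho> @ [a]) g) E"
  proof (rule dE)
    show "\<forall>i<n. joinl (u @ \<rho> @ [a]) g ! i = join (conc u h) g i"
    proof (intro allI impI)
      fix i assume "i < n"
      have "join (conc u h) g i = join (nth0 (u @ \<rho> @ [a])) g i"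
        using \<open>i < n\<close> by (auto simp: join_def conc_def nth0_def v nth_append)
      then show "joinl (u @ \<rho> @ [a]) g ! i = join (conc u h) g i"
        using \<open>i < n\<close> by (simp add: joinl_def v)
    qed
  qed (simp add: v)
  \<comment> \<open>Slot \<open>length L\<close> holds \<open>restr f m\<close>, derived by
    \<open>E\<close>; the slot after it holds the empty string required by
    \<open>cert\<close>.\<close>
  define C where "C = map (\<lambda>j. prod_encode (list_encode (if j \<le> length L then Z j else []),
    list_encode (if j < length L then D j else E))) [0..<Suc (Suc (length L))]"
  define t where "t = prod_encode (list_encode \<rho>, list_encode C)"
  have C: "pfst (nth0 C j) = list_encode (if j \<le> length L then Z j else [])"
    "psnd (nth0 C j) = list_encode (if j < length L then D j else E)" if "j < Suc (Suc (length L))" for j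
    using that nth_map_upt[of j "Suc (Suc (length L))" 0] unfolding C_def nth0_def
    by (simp_all del: upt_Suc)
  have out: "cert_out t j = (if j \<le> length L then Z j else [])"
    and der: "cert_deriv t j = (if j < length L then D j else E)"
    if "j < Suc (Suc (length L))" for j using C[OF that] by (simp_all add: t_def)
  have "cert T g u a e L t" unfolding cert_def
  proof (intro conjI allI impI)
    show "cert_leaf t \<in> leaves T" by (simp add: t_def \<rho>)
    show "length L < length (cert_out t 0)" "length (cert_out t (Suc (length L))) = 0"
      by (simp_all only: out) (simp_all add: Z)
    fix j assume j: "j < Suc (length L)"
    then have j': "j < Suc (Suc (length L))" "Suc j < Suc (Suc (length L))" by simp_all
    show "derivation (joinl (u @ cert_leaf (nth0 (L @ [t]) j) @ a # cert_out t (Suc j)) g) (cert_deriv t j)"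
    proof (cases "j < length L")
      case True
      then show ?thesis unfolding out[OF j'(2)] der[OF j'(1)] using Z(3)[OF True]
        by (simp add: nth0_def nth_append)
    next
      case False
      with j have "j = length L" by simp
      then show ?thesis unfolding out[OF j'(2)] der[OF j'(1)] using d
        by (simp add: nth0_def t_def)
    qed
    fix k assume "k < length (cert_out t j)"
    then show "entry e k (nth0 (cert_out t j) k) \<in> set (cert_deriv t j)"
      unfolding out[OF j'(1)] der[OF j'(1)] using Z(2) Z(3)[of j] E j
      by (cases "j < length L") (auto simp: nth0_def less_Suc_eq)
  qed
  then show ?thesis by blast
qed

section \<open>The sequence of least certificates and its limit\<close>

primrec certs :: "nat \<Rightarrow> nat list" where
  "certs 0 = []"
| "certs (Suc n) = certs n @ [LEAST t. cert T g u a e (certs n) t]"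

lemma length_certs [simp]: "length (certs n) = n"
  by (induction n) simp_all

lemma certs_leaves: "\<forall>t\<in>set (certs n). cert_leaf t \<in> leaves T"
proof (induction n)
  case (Suc n)
  have "cert T g u a e (certs n) (LEAST t. cert T g u a e (certs n) t)"
    using cert_exists[OF Suc] by (rule LeastI_ex)
  with Suc show ?case by (simp add: cert_def)
qed simp

lemma cert_Least: "cert T g u a e (certs n) (LEAST t. cert T g u a e (certs n) t)"
  using cert_exists[OF certs_leaves] by (rule LeastI_ex)

lemma certs_take: "k \<le> n \<Longrightarrow> take k (certs n) = certs k"
  by (induction n) (auto simp: le_Suc_eq)

lemma certs_nth: "k < n \<Longrightarrow> certs n ! k = (LEAST t. cert T g u a e (certs k) t)"
  by (induction n) (auto simp: less_Suc_eq nth_append)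

text \<open>Taking least certificates makes the solution unique, so the searches for different
  \<open>n\<close> find segments of one sequence.\<close>

lemma cert_search_iff: "cert_search T g u a e n L \<longleftrightarrow> L = certs (Suc n)"
proof
  assume s: "cert_search T g u a e n L"
  then have len: "length L = Suc n" by (simp add: cert_search_def)
  have "k \<le> Suc n \<Longrightarrow> take k L = certs k" for k
  proof (induction k)
    case (Suc k)
    then have k: "k < Suc n" and IH: "take k L = certs k" by simp_all
    from s k have "cert T g u a e (certs k) (L ! k)" "\<forall>t<L ! k. \<not> cert T g u a e (certs k) t"
      by (auto simp: cert_search_def nth0_def IH[symmetric])
    then have "L ! k = (LEAST t. cert T g u a e (certs k) t)"
      by (intro Least_equality[symmetric]) (auto simp: not_less[symmetric])
    then show ?case using k len IH by (simp add: take_Suc_conv_app_nth)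
  qed simp
  from this[of "Suc n"] len show "L = certs (Suc n)" by simp
next
  assume L: "L = certs (Suc n)"
  have 1: "nth0 L k = (LEAST t. cert T g u a e (certs k) t)" and 2: "take k L = certs k" if "k < Suc n" for k
    using that certs_nth[OF that] certs_take[of k "Suc n"] unfolding L by (simp_all only: nth0_def length_certs if_True less_imp_le)
  then show "cert_search T g u a e n L"
    unfolding cert_search_def
  proof (intro conjI allI impI)
    show "length L = Suc n" by (simp only: L length_certs)
    fix k assume k: "k < Suc n"
    show "cert T g u a e (take k L) (nth0 L k)" unfolding 1[OF k] 2[OF k] by (rule cert_Least)
    show "\<not> cert T g u a e (take k L) t" if "t < nth0 L k" for t
      using that unfolding 1[OF k] 2[OF k] by (rule not_less_Least)
  qed
qed

text \<open>\<open>paths T\<close> is closed: below \<open>m\<close> the limit agrees with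
  \<open>nest (certs m) h\<close>, which belongs to it.\<close>

lemma nested_limit_in_paths:
  "(\<lambda>n. nth0 (cert_out (nth0 (certs (Suc n)) n) 0) n) \<in> paths T" (is "?x \<in> _")
proof -
  obtain h where h: "h \<in> paths T" using special by (auto simp: special_def)
  have x: "?x n = nest (certs m) h n" if "n < m" for n m
  proof -
    let ?t = "LEAST t. cert T g u a e (certs n) t" and ?r = "drop (Suc n) (certs m)"
    \<comment> \<open>The later certificates are absorbed into the innermost argument, for which
      \<open>cert_sound\<close> admits any member of the class.\<close>
    have m: "certs m = (certs n @ [?t]) @ ?r"
      using certs_take[of "Suc n" m] that by (metis append_take_drop_id certs.simps(2) Suc_leI)
    have "\<forall>t\<in>set ?r. cert_leaf t \<in> leaves T" using certs_leaves by (meson in_set_dropD)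
    from nest_in_paths[OF this h] have "nest ?r h \<in> paths T" .
    then have "\<forall>k<length (cert_out ?t 0). cert_out ?t 0 ! k = nest (certs n @ [?t]) (nest ?r h) k"
      using cert_sound[OF certs_leaves cert_Least, of "nest ?r h" 0 n] by simp
    moreover have "nest (certs m) h = nest (certs n @ [?t]) (nest ?r h)"
      by (subst m) (simp add: nest_def)
    moreover have "n < length (cert_out ?t 0)" using cert_Least[of n] by (simp add: cert_def)
    moreover have "nth0 (certs (Suc n)) n = ?t" by (simp add: nth0_def nth_append)
    ultimately show ?thesis by (simp add: nth0_def)
  qed
  have "restr ?x m = restr (nest (certs m) h) m" for m
    by (rule restr_eqI) (simp_all add: x del: certs.simps)
  then show ?thesis using nest_in_paths[OF certs_leaves h] by (simp add: paths_def)
qed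

end

section \<open>Learning a stable position\<close>

text \<open>
  The number \<open>\<langle>\<langle>\<rho>\<^sub>0, \<dots>, \<rho>\<^bsub>n-1\<^esub>\<rangle>, \<langle>\<tau>, a\<rangle>\<rangle>\<close> codes the string \<open>\<rho>\<^sub>0 \<tau>(0) \<dots> \<rho>\<^bsub>n-1\<^esub> \<tau>(n-1)\<close> together with the
  bit \<open>a\<close> to be read after the next leaf.
\<close>

abbreviation pos_leaves :: "nat \<Rightarrow> nat list list" where
  "pos_leaves i \<equiv> map list_decode (list_decode (pfst i))"

abbreviation pos_path :: "nat \<Rightarrow> nat list" where
  "pos_path i \<equiv> list_decode (pfst (psnd i))"

abbreviation pos_next :: "nat \<Rightarrow> nat" where
  "pos_next i \<equiv> psnd (psnd i)"

definition pos_string :: "nat \<Rightarrow> nat list" where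
  "pos_string i = interleave (pos_leaves i) (pos_path i)"

definition valid_pos :: "nat list set \<Rightarrow> nat list set \<Rightarrow> nat \<Rightarrow> bool" where
  "valid_pos TQ TP i \<longleftrightarrow> length (list_decode (pfst i)) = length (pos_path i) \<and>
     (\<forall>k<length (pos_path i). list_decode (nth0 (list_decode (pfst i)) k) \<in> leaves TP) \<and>
     pos_path i @ [pos_next i] \<in> TQ"

definition stable :: "nat list set \<Rightarrow> nat list set \<Rightarrow> (nat list \<Rightarrow> nat) \<Rightarrow> (nat \<Rightarrow> nat) \<Rightarrow> nat \<Rightarrow> bool" where
  "stable TQ TP \<psi> g i \<longleftrightarrow> valid_pos TQ TP i \<and>
     (\<forall>\<eta>\<in>extensions TP (pos_next i). \<psi> (joinl (pos_string i @ \<eta>) g) = \<psi> (joinl (pos_string i) g))"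

text \<open>Here \<sigma> is the known segment of the oracle. The length bound keeps
  \<open>joinl\<close> inside it, so a refutation stays valid for longer segments.\<close>

definition refuted ::
    "nat list set \<Rightarrow> nat list set \<Rightarrow> (nat list \<Rightarrow> nat) \<Rightarrow> nat list \<Rightarrow> nat \<Rightarrow> nat \<Rightarrow> bool" where
  "refuted TQ TP \<psi> \<sigma> i v \<longleftrightarrow> \<not> valid_pos TQ TP i \<or>
     list_decode v \<in> extensions TP (pos_next i) \<and>
     length (pos_string i @ list_decode v) \<le> length \<sigma> \<and>
     \<psi> (joinl (pos_string i @ list_decode v) (nth0 \<sigma>)) \<noteq> \<psi> (joinl (pos_string i) (nth0 \<sigma>))"

text \<open>The default \<open>length \<sigma>\<close> makes the search bounded; it no longer
  matters once it exceeds the least stable position.\<close>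

definition guess :: "nat list set \<Rightarrow> nat list set \<Rightarrow> (nat list \<Rightarrow> nat) \<Rightarrow> nat list \<Rightarrow> nat" where
  "guess TQ TP \<psi> \<sigma> =
     (LEAST i. i = length \<sigma> \<or> (\<forall>v<length \<sigma>. \<not> refuted TQ TP \<psi> \<sigma> i v))"

lemma valid_posD:
  assumes "valid_pos TQ TP i"
  shows "set (pos_leaves i) \<subseteq> leaves TP" "length (pos_leaves i) = length (pos_path i)"
    "pos_path i @ [pos_next i] \<in> TQ"
  using assms unfolding valid_pos_def by (auto simp: in_set_conv_nth nth0_def)

lemma stable_exists:
  assumes "computable_tree TP" "special (paths TP)" "q \<in> paths TQ"
    and "\<And>x. x \<in> hyperconcat TQ TP \<Longrightarrow> convergent (\<lambda>n. \<psi> (restr (join x g) n))"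
  shows "\<exists>i. stable TQ TP \<psi> g i"
proof -
  obtain S \<tau> a where S: "set S \<subseteq> leaves TP" "length S = length \<tau>" "\<tau> @ [a] \<in> TQ"
    "\<forall>\<eta>\<in>extensions TP a. \<psi> (joinl (interleave S \<tau> @ \<eta>) g) = \<psi> (joinl (interleave S \<tau>) g)"
    using stable_position_exists[OF assms] by blast
  define i where "i = prod_encode (list_encode (map list_encode S), prod_encode (list_encode \<tau>, a))"
  have "pos_leaves i = S" "pos_path i = \<tau>" "pos_next i = a"
    by (simp_all add: i_def o_def)
  moreover from this S have "valid_pos TQ TP i"
    unfolding valid_pos_def by (auto simp: nth0_def i_def dest!: subsetD[OF S(1), OF nth_mem])
  ultimately have "stable TQ TP \<psi> g i" using S(4) by (simp only: stable_def pos_string_def)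
  then show ?thesis by blast
qed

lemma joinl_nth0_restr: "length u \<le> n \<Longrightarrow> joinl u (nth0 (restr g n)) = joinl u g"
  by (rule joinl_cong) (simp add: nth0_def)

lemma refuted_restr:
  "refuted TQ TP \<psi> (restr g n) i v \<longleftrightarrow> \<not> valid_pos TQ TP i \<or>
     list_decode v \<in> extensions TP (pos_next i) \<and> length (pos_string i @ list_decode v) \<le> n \<and>
     \<psi> (joinl (pos_string i @ list_decode v) g) \<noteq> \<psi> (joinl (pos_string i) g)"
  unfolding refuted_def using joinl_nth0_restr[of "pos_string i @ list_decode v" n g]
    joinl_nth0_restr[of "pos_string i" n g] by auto

text \<open>Each of the finitely many smaller positions is refuted from some stage on, since
  refutations persist; a stable position never is.\<close>

lemma guess_converges:
  assumes "stable TQ TP \<psi> g i" and least: "\<And>j. j < i \<Longrightarrow> \<not> stable TQ TP \<psi> g j"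
  shows "\<forall>\<^sub>F n in sequentially. guess TQ TP \<psi> (restr g n) = i"
proof -
  have "\<forall>\<^sub>F n in sequentially. \<exists>v<n. refuted TQ TP \<psi> (restr g n) j v" if "j < i" for j
  proof (cases "valid_pos TQ TP j")
    case False
    then have "\<exists>v<n. refuted TQ TP \<psi> (restr g n) j v" if "1 \<le> n" for n
      using that unfolding refuted_restr by (intro exI[of _ 0]) simp
    then show ?thesis unfolding eventually_sequentially by blast
  next
    case True
    then obtain \<eta> where \<eta>: "\<eta> \<in> extensions TP (pos_next j)"
      "\<psi> (joinl (pos_string j @ \<eta>) g) \<noteq> \<psi> (joinl (pos_string j) g)"
      using least[OF \<open>j < i\<close>] by (auto simp: stable_def)
    let ?m = "max (Suc (list_encode \<eta>)) (length (pos_string j @ \<eta>))"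
    have "\<exists>v<n. refuted TQ TP \<psi> (restr g n) j v" if "?m \<le> n" for n
      unfolding refuted_restr using \<eta> that by (intro exI[of _ "list_encode \<eta>"]) auto
    then show ?thesis unfolding eventually_sequentially by blast
  qed
  then have "\<forall>\<^sub>F n in sequentially. \<forall>j\<in>{..<i}. \<exists>v<n. refuted TQ TP \<psi> (restr g n) j v"
    by (intro eventually_ball_finite) auto
  moreover have "\<forall>\<^sub>F n in sequentially. i < n" by (rule eventually_gt_at_top)
  ultimately show ?thesis
  proof eventually_elim
    case (elim n)
    have "\<not> refuted TQ TP \<psi> (restr g n) i v" for v
      using assms(1) unfolding refuted_restr stable_def by blast
    with elim show ?case unfolding guess_def
      by (intro Least_equality) (auto simp: not_less[symmetric])
  qed
qed

section \<open>Computability of the guesses\<close>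

lemma comp_list_pos_string:
  assumes "comp_fun A" shows "comp_list (\<lambda>g x. pos_string (A g x))"
proof -
  define body where "body i k v = list_encode (list_decode v @
    list_decode (nth0 (list_decode (pfst i)) k) @ [nth0 (pos_path i) k])" for i k v
  let ?n = "\<lambda>i. if length (list_decode (pfst i)) < length (pos_path i)
    then length (list_decode (pfst i)) else length (pos_path i)"
  have "rec_nat 0 (body i) (?n i) = list_encode (pos_string i)" for i
  proof -
    have "k \<le> ?n i \<Longrightarrow> rec_nat 0 (body i) k =
      list_encode (interleave (take k (pos_leaves i)) (take k (pos_path i)))" for k
    proof (induction k)
      case (Suc k)
      then have "k < length (list_decode (pfst i))" "k < length (pos_path i)" by (auto split: if_splits)
      with Suc show ?case
        by (simp add: take_Suc_conv_app_nth interleave_snoc body_def nth0_def)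
    qed (simp add: interleave_def)
    moreover have "interleave (take (?n i) (pos_leaves i)) (take (?n i) (pos_path i)) = pos_string i"
      unfolding interleave_def pos_string_def take_zip[symmetric] by simp
    ultimately show ?thesis by simp
  qed
  moreover have "comp_fun (\<lambda>g i. rec_nat 0 (body i) (?n i))"
    unfolding body_def by (intro comp_intros)
  ultimately have "comp_fun (\<lambda>g i. list_encode (pos_string i))" by simp
  from comp_fun_comp[OF this assms] show ?thesis by (simp add: comp_list_def)
qed

text \<open>The split point is bounded by the length, which makes membership decidable for a
  computable tree.\<close>

lemma extensions_iff:
  "\<eta> \<in> extensions T a \<longleftrightarrow> \<eta> \<in> T \<or>
     (\<exists>k<length \<eta>. take k \<eta> \<in> leaves T \<and> nth0 \<eta> k = a \<and> drop (Suc k) \<eta> \<in> T)"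
proof
  assume "\<eta> \<in> extensions T a"
  then consider "\<eta> \<in> T" | \<rho> \<sigma> where "\<rho> \<in> leaves T" "\<sigma> \<in> T" "\<eta> = \<rho> @ a # \<sigma>"
    unfolding extensions_def by blast
  then show "\<eta> \<in> T \<or> (\<exists>k<length \<eta>. take k \<eta> \<in> leaves T \<and> nth0 \<eta> k = a \<and> drop (Suc k) \<eta> \<in> T)"
  proof cases
    case 2
    then show ?thesis by (intro disjI2 exI[of _ "length \<rho>"]) (simp add: nth0_def)
  qed simp
next
  assume "\<eta> \<in> T \<or> (\<exists>k<length \<eta>. take k \<eta> \<in> leaves T \<and> nth0 \<eta> k = a \<and> drop (Suc k) \<eta> \<in> T)"
  then show "\<eta> \<in> extensions T a"
  proof (elim disjE exE conjE)
    fix k assume "k < length \<eta>" "take k \<eta> \<in> leaves T" "nth0 \<eta> k = a" "drop (Suc k) \<eta> \<in> T"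
    moreover from this have "\<eta> = take k \<eta> @ a # drop (Suc k) \<eta>"
      by (metis id_take_nth_drop nth0_def)
    ultimately show ?thesis unfolding extensions_def by blast
  qed (simp add: extensions_def)
qed

lemma comp_fun_guess:
  assumes TQ: "computable_tree TQ" and TP: "computable_tree TP" and \<psi>: "computable_list_fun \<psi>"
  shows "comp_fun (\<lambda>_ x. guess TQ TP \<psi> (list_decode x))"
proof -
  have "comp_pred (\<lambda>g z. refuted TQ TP \<psi> (list_decode (pfst (pfst z))) (psnd (pfst z)) (psnd z))"
    unfolding refuted_def valid_pos_def extensions_iff
    by (intro comp_intros comp_pred_leaves[OF TP] comp_pred_tree[OF TP] comp_pred_tree[OF TQ]
        comp_fun_list_fun[OF \<psi>] comp_list_joinl comp_list_pos_string)
  then show ?thesis unfolding guess_def by (intro comp_fun_bounded_Least comp_intros)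
qed

section \<open>The reduction\<close>

text \<open>The s-m-n theorem: \<open>i\<close> is wired into the program by a constant
  program.\<close>

lemma parametrization:
  "\<exists>f. comp_fun (\<lambda>_. f) \<and> (\<forall>g i n. ev g (decode (f i)) n = ev g c (prod_encode (i, n)))"
proof -
  define const where "const = rec_nat CZero (\<lambda>_. CComp CSucc)"
  define f where "f i = encode (CComp c (CPair (const i) (CPair CFst CSnd)))" for i
  have "ev g (const i) n = Some i" for g i n by (induction i) (simp_all add: const_def)
  then have "ev g (decode (f i)) n = ev g c (prod_encode (i, n))" for g i n
    by (simp add: f_def decode_encode del: encode.simps)
  moreover have "comp_fun (\<lambda>_. f)"
  proof -
    \<comment> \<open>The numbers 0 and 1 are \<open>encode CZero\<close> and
      \<open>encode CSucc\<close>; the offset 6 belongs to \<open>CComp\<close>, and 5 below to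
      \<open>CPair\<close>.\<close>
    have "rec_nat 0 (\<lambda>_ v. 4 * prod_encode (1, v) + 6) i = encode (const i)" for i
      by (induction i) (simp_all add: const_def)
    moreover have "comp_fun (\<lambda>g i. 4 * prod_encode (encode c,
      4 * prod_encode (rec_nat 0 (\<lambda>_ v. 4 * prod_encode (1, v) + 6) i, encode (CPair CFst CSnd)) + 5) + 6)"
      by (intro comp_intros)
    ultimately show ?thesis by (simp add: f_def[abs_def])
  qed
  ultimately show ?thesis by blast
qed

text \<open>One program serves all oracles and positions, so \<open>parametrization\<close> can turn
  a guessed position into an index computably.\<close>

lemma nested_machine:
  assumes TP: "computable_tree TP" and \<psi>: "computable_list_fun \<psi>"
  shows "\<exists>c. \<forall>g i. nested_functional TP g (pos_string i) (pos_next i) (\<psi> (joinl (pos_string i) g)) \<longrightarrow>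
    (\<exists>y\<in>paths TP. \<forall>n. ev g c (prod_encode (i, n)) = Some (y n))"
proof -
  define srch where "srch g i n L = cert_search TP g (pos_string i) (pos_next i)
    (\<psi> (joinl (pos_string i) g)) n L" for g i n L
  have "comp_fun (\<lambda>g z. if \<not> srch g (pfst (pfst z)) (psnd (pfst z)) (list_decode (psnd z)) then 1 else 0)"
    unfolding comp_pred_def[symmetric] srch_def
    by (intro comp_intros comp_pred_cert_search[OF TP] comp_fun_list_fun[OF \<psi>] comp_list_joinl
        comp_list_pos_string)
  then obtain c where c: "\<And>g z. ev g c z =
      Some (if \<not> srch g (pfst (pfst z)) (psnd (pfst z)) (list_decode (psnd z)) then 1 else 0)"
    unfolding comp_fun_def by blast
  have "comp_fun (\<lambda>g z. nth0 (cert_out (nth0 (list_decode (psnd z)) (psnd (pfst z))) 0) (psnd (pfst z)))"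
    by (intro comp_intros)
  then obtain d where d: "\<And>g z. ev g d z =
      Some (nth0 (cert_out (nth0 (list_decode (psnd z)) (psnd (pfst z))) 0) (psnd (pfst z)))"
    unfolding comp_fun_def by blast
  show ?thesis
  proof (intro exI allI impI)
    fix g i
    assume "nested_functional TP g (pos_string i) (pos_next i) (\<psi> (joinl (pos_string i) g))"
    then interpret nested_functional TP g "pos_string i" "pos_next i" "\<psi> (joinl (pos_string i) g)" .
    have srch: "srch g i n L \<longleftrightarrow> L = certs (Suc n)" for n L unfolding srch_def by (rule cert_search_iff)
    have zero: "ev g c (prod_encode (prod_encode (i, n), m)) = Some 0 \<longleftrightarrow> m = list_encode (certs (Suc n))"
      for n m unfolding c prod_encode_inverse fst_conv snd_conv srch
      by (simp del: certs.simps) (metis list_decode_inverse list_encode_inverse)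
    have "ev g (CMin c) (prod_encode (i, n)) = Some (list_encode (certs (Suc n)))" for n
    proof -
      have "\<exists>k. ev g c (prod_encode (prod_encode (i, n), k)) = Some 0 \<and>
        (\<forall>m<k. ev g c (prod_encode (prod_encode (i, n), m)) \<noteq> None)"
        unfolding zero by (auto simp: c)
      then show ?thesis unfolding ev.simps zero by (simp only: if_True Least_eq_0) (simp add: Least_equality)
    qed
    then have "ev g (CComp d (CPair (CPair CFst CSnd) (CMin c))) (prod_encode (i, n)) =
      Some (nth0 (cert_out (nth0 (certs (Suc n)) n) 0) n)" for n
      by (simp add: d del: certs.simps ev.simps(9))
    then show "\<exists>y\<in>paths TP. \<forall>n.
        ev g (CComp d (CPair (CPair CFst CSnd) (CMin c))) (prod_encode (i, n)) = Some (y n)"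
      by (intro bexI[OF _ nested_limit_in_paths]) blast
  qed
qed

text \<open>The guesses converge, and at the lengths \<open>2 * (length u + m)\<close> they equal
  \<open>e\<close>.\<close>

lemma learned_value:
  assumes "\<And>m. \<psi> (joinl (u @ restr h m) g) = e"
    and "convergent (\<lambda>n. \<psi> (restr (join (conc u h) g) n))"
  shows "lim (\<lambda>n. \<psi> (restr (join (conc u h) g) n)) = (e :: nat)"
proof -
  obtain l where l: "(\<lambda>n. \<psi> (restr (join (conc u h) g) n)) \<longlonglongrightarrow> l"
    using assms(2) by (auto simp: convergent_def)
  then obtain N where "\<And>n. N \<le> n \<Longrightarrow> \<psi> (restr (join (conc u h) g) n) = l"
    unfolding tendsto_discrete eventually_sequentially by blast
  from this[of "2 * (length u + N)"] have "l = e"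
    using assms(1)[of N] by (simp add: restr_conc[symmetric] joinl_restr)
  with l show ?thesis by (simp add: limI)
qed

text \<open>The points \<open>u h\<close> and \<open>u \<rho> a h\<close> are in the
  hyperconcatenation, so the learner succeeds on them; by stability it does so with the same index
  on all of them.\<close>

lemma stable_nested_functional:
  assumes TP: "computable_tree TP" "special (paths TP)" and TQ: "computable_tree TQ"
    and st: "stable TQ TP \<psi> g i"
    and conv: "\<And>x. x \<in> hyperconcat TQ TP \<Longrightarrow> convergent (\<lambda>n. \<psi> (restr (join x g) n))"
    and val: "\<And>x. x \<in> hyperconcat TQ TP \<Longrightarrow>
      \<exists>y\<in>paths TP. Phi (lim (\<lambda>n. \<psi> (restr (join x g) n))) (join x g) = Some y"
  shows "nested_functional TP g (pos_string i) (pos_next i) (\<psi> (joinl (pos_string i) g))"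
proof
  have valid: "valid_pos TQ TP i"
    and const: "\<And>\<eta>. \<eta> \<in> extensions TP (pos_next i) \<Longrightarrow>
      \<psi> (joinl (pos_string i @ \<eta>) g) = \<psi> (joinl (pos_string i) g)"
    using st by (auto simp: stable_def)
  note v = valid_posD[OF valid]
  show "computable_tree TP" "special (paths TP)" by (rule TP)+
  fix h assume h: "h \<in> paths TP"
  have "pos_path i \<in> TQ" using TQ v(3) by (auto simp: computable_tree_def binary_tree_def)
  then have "conc (pos_string i) h \<in> hyperconcat TQ TP"
    unfolding pos_string_def using conc_in_hyperconcat[OF h v(1)] v(2) by simp
  moreover from h have "restr h m \<in> extensions TP (pos_next i)" for m
    by (simp add: paths_def extensions_def)
  ultimately show "\<exists>y\<in>paths TP. Phi (\<psi> (joinl (pos_string i) g)) (join (conc (pos_string i) h) g) = Some y"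
    using learned_value[of \<psi> "pos_string i" h g] const conv val by metis
  fix \<rho> assume \<rho>: "\<rho> \<in> leaves TP"
  let ?u = "pos_string i @ \<rho> @ [pos_next i]"
  have u: "?u = interleave (pos_leaves i @ [\<rho>]) (pos_path i @ [pos_next i])"
    using interleave_snoc[OF v(2)] by (simp add: pos_string_def)
  have "conc ?u h \<in> hyperconcat TQ TP"
    unfolding u using \<rho> v by (intro conc_in_hyperconcat h) auto
  moreover have "\<psi> (joinl (?u @ restr h m) g) = \<psi> (joinl (pos_string i) g)" for m
    using h \<rho> const[of "\<rho> @ pos_next i # restr h m"] by (auto simp: paths_def extensions_def)
  ultimately show "\<exists>y\<in>paths TP. Phi (\<psi> (joinl (pos_string i) g)) (join (conc ?u h) g) = Some y"
    using learned_value[of \<psi> ?u h g] conv val by metis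
qed

theorem theorem53:
  fixes P Q R :: "(nat \<Rightarrow> nat) set" and TP TQ :: "nat list set"
  assumes "pi01_class P" and "pi01_class Q"
    and "special P" and "special Q"
    and "computable_tree TP" and "paths TP = P"
    and "computable_tree TQ" and "paths TQ = Q"
    and "learn_reducible P (join_prod (hyperconcat TQ TP) R)"
  shows "learn_reducible P R"
proof -
  obtain \<Gamma> \<psi> where dom: "join_prod (hyperconcat TQ TP) R \<subseteq> dom \<Gamma>"
    and val: "\<forall>g\<in>join_prod (hyperconcat TQ TP) R. the (\<Gamma> g) \<in> P"
    and \<psi>: "computable_list_fun \<psi>" and \<Gamma>: "learnable_via \<Gamma> \<psi>"
    using assms(9) by (auto simp: learn_reducible_def learner_def)
  have special: "special (paths TP)" using assms by simp
  obtain q where q: "q \<in> paths TQ" using assms by (auto simp: special_def)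
  obtain c where c: "\<And>g i. nested_functional TP g (pos_string i) (pos_next i) (\<psi> (joinl (pos_string i) g)) \<Longrightarrow>
    \<exists>y\<in>paths TP. \<forall>n. ev g c (prod_encode (i, n)) = Some (y n)"
    using nested_machine[OF assms(5) \<psi>] by blast
  obtain f where f: "comp_fun (\<lambda>_. f)" "\<And>g i n. ev g (decode (f i)) n = ev g c (prod_encode (i, n))"
    using parametrization[of c] by blast
  \<comment> \<open>The new learner proposes the index of the nested search at the currently guessed
    position.\<close>
  define \<psi>' where "\<psi>' \<sigma> = f (guess TQ TP \<psi> \<sigma>)" for \<sigma>
  have "learner \<psi>'" unfolding learner_def computable_list_fun_def \<psi>'_def
    by (intro computable_comp_fun comp_fun_comp[OF f(1)] comp_fun_guess assms \<psi>)
  have limit: "\<exists>l y. (\<lambda>n. \<psi>' (restr g n)) \<longlonglongrightarrow> l \<and> y \<in> P \<and> Phi l g = Some y" if g: "g \<in> R" for g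
  proof -
    have x: "convergent (\<lambda>n. \<psi> (restr (join x g) n))"
      "\<exists>y\<in>paths TP. Phi (lim (\<lambda>n. \<psi> (restr (join x g) n))) (join x g) = Some y"
      if "x \<in> hyperconcat TQ TP" for x
    proof -
      have j: "join x g \<in> join_prod (hyperconcat TQ TP) R" using that g by (auto simp: join_prod_def)
      then obtain y where "\<Gamma> (join x g) = Some y" using dom by blast
      with j \<Gamma> val show "convergent (\<lambda>n. \<psi> (restr (join x g) n))"
        "\<exists>y\<in>paths TP. Phi (lim (\<lambda>n. \<psi> (restr (join x g) n))) (join x g) = Some y"
        using assms(6) by (auto simp: learnable_via_def domI dest!: bspec)
    qed
    define i where "i = (LEAST i. stable TQ TP \<psi> g i)"
    have st: "stable TQ TP \<psi> g i" unfolding i_def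
      using stable_exists[OF assms(5) special q x(1)] by (rule LeastI_ex)
    have "\<forall>\<^sub>F n in sequentially. guess TQ TP \<psi> (restr g n) = i"
      using guess_converges[OF st] not_less_Least unfolding i_def by blast
    then have "(\<lambda>n. \<psi>' (restr g n)) \<longlonglongrightarrow> f i"
      unfolding tendsto_discrete \<psi>'_def by (auto elim: eventually_mono)
    moreover obtain y where "y \<in> paths TP" "\<And>n. ev g c (prod_encode (i, n)) = Some (y n)"
      using c[OF stable_nested_functional[OF assms(5) special assms(7) st x]] by blast
    ultimately show ?thesis using f(2) assms(6) by (auto simp: Phi_def)
  qed
  \<comment> \<open>The functional is cut down to \<open>R\<close> because
    \<open>learnable_via\<close> demands convergence on its whole domain.\<close>
  define \<Gamma>' where "\<Gamma>' g = (if g \<in> R then Phi (lim (\<lambda>n. \<psi>' (restr g n))) g else None)" for g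
  have \<Gamma>': "convergent (\<lambda>n. \<psi>' (restr g n))" "\<exists>y\<in>P. \<Gamma>' g = Some y" if "g \<in> R" for g
    using limit[OF that] that by (auto simp: \<Gamma>'_def convergent_def limI)
  have "learnable_via \<Gamma>' \<psi>'"
    unfolding learnable_via_def using \<Gamma>' by (auto simp: \<Gamma>'_def split: if_splits)
  with \<open>learner \<psi>'\<close> \<Gamma>' show ?thesis
    unfolding learn_reducible_def by (intro exI[of _ \<Gamma>'] exI[of _ \<psi>']) fastforce
qed

end
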